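(* Let $R$ be a commutative ring, let $\Gamma$ be a finite group, and let $\mathcal{Y}\le\mathcal{X}_R(\Gamma)$ be a subgroup of the $R$-character group of $\Gamma$. Let $\Phi=(X,* )$ be a fusion law with a distinguished unit and with a $\Gamma$-grading $\xi\colon X\to\Gamma$, and let $\lambda\colon X\to R$ be an evaluation map (an arbitrary map). Let $\mathcal{C}$ be the full subcategory of $(\Phi,\lambda)\text{-}\mathbf{AxDec}_R$ consisting of the axial decomposition algebras that are Miyamoto-stable and of unique type with respect to $\mathcal{Y}$. Then $\widehat{\mathrm{Miy}}_{\mathcal{Y}}\colon\mathcal{C}\to\mathbf{Grp}$ is a functor, where a morphism $(\varphi,\psi)\colon(A,\mathcal{I},\Omega,\alpha)\to(B,\mathcal{J},\Omega',\beta)$ of $\mathcal{C}$ is sent to the group homomorphism $\widehat{\mathrm{Miy}}_{\mathcal{Y}}(A,\mathcal{I},\Omega)\to\widehat{\mathrm{Miy}}_{\mathcal{Y}}(B,\mathcal{J},\Omega')$ determined by $t_{i,\chi}\mapsto t_{\psi(i),\chi}$ for $i\in\mathcal{I}$, $\chi\in\mathcal{Y}$.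
   Context: Fusion laws. A fusion law is a pair $(X,* )$ with $X$ a set and $*\colon X\times X\to 2^X$ a map. An element $e\in X$ is a unit if $e*x\subseteq\{x\}$ and $x*e\subseteq\{x\}$ for all $x\in X$. A $\Gamma$-grading of $(X,* )$ is a map $\xi\colon X\to\Gamma$ with $\xi(z)=\xi(x)\xi(y)$ whenever $z\in x*y$. Decomposition algebras. $R$-algebras are not assumed commutative, associative or unital. A $\Phi$-decomposition of an $R$-algebra $A$ is a direct sum decomposition of $R$-modules $A=\bigoplus_{x\in X}A_x$ with $A_xA_y\subseteq\bigoplus_{z\in x*y}A_z$ for all $x,y\in X$. A $\Phi$-decomposition algebra is a triple $(A,\mathcal{I},\Omega)$ with $\mathcal{I}$ an index set and $\Omega=((A^i_x)_{x\in X}\mid i\in\mathcal{I})$ a tuple of (not necessarily distinct) $\Phi$-decompositions of $A$. Morphisms $(A,\mathcal{I},\Omega_A)\to(B,\mathcal{J},\Omega_B)$ are pairs $(\varphi,\psi)$ with $\varphi\colon A\to B$ an $R$-algebra morphism and $\psi\colon\mathcal{I}\to\mathcal{J}$ a map such that $\varphi(A^i_x)\subseteq B^{\psi(i)}_x$ for all $x\in X$, $i\in\mathcal{I}$. The category $(\Phi,\lambda)\text{-}\mathbf{AxDec}_R$. Let $e\in X$ be the distinguished unit and write $\lambda_x=\lambda(x)$. Objects are quadruples $(A,\mathcal{I},\Omega,\alpha)$ with $(A,\mathcal{I},\Omega)$ a $\Phi$-decomposition algebra over $R$ and $\alpha\colon\mathcal{I}\to A$, $i\mapsto a_i$, a map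 such that each $a_i$ (a left axis) is a non-zero element of $A^i_e$ and $a_i\cdot b=\lambda_x b$ for all $x\in X$, $b\in A^i_x$. Morphisms $(A,\mathcal{I},\Omega_A,\alpha)\to(B,\mathcal{J},\Omega_B,\beta)$ are morphisms $(\varphi,\psi)$ of decomposition algebras with $\varphi\circ\alpha=\beta\circ\psi$. Miyamoto maps. $\mathcal{X}_R(\Gamma)$ is the group of all homomorphisms $\Gamma\to R^\times$ under pointwise multiplication. Via $\xi$, each $(A,\mathcal{I},\Omega,\alpha)$ is viewed as a $\Gamma$-decomposition algebra (that is, with components indexed by $\Gamma$ and $A^i_gA^i_h\subseteq A^i_{gh}$) by $A^i_g:=\bigoplus_{x\in\xi^{-1}(g)}A^i_x$. For $i\in\mathcal{I}$, $\chi\in\mathcal{Y}$, the Miyamoto map $\tau_{i,\chi}\in\mathrm{Aut}(A)$ is the $R$-linear map with $\tau_{i,\chi}(a)=\chi(g)a$ for all $a\in A^i_g$, $g\in\Gamma$. Miyamoto-stable with respect to $\mathcal{Y}$: for each $i\in\mathcal{I}$, $\chi\in\mathcal{Y}$ there is a permutation $\pi_{i,\chi}$ of $\mathcal{I}$ such that $(\tau_{i,\chi},\pi_{i,\chi})$ is an automorphism of $(A,\mathcal{I},\Omega,\alpha)$ in $(\Phi,\lambda)\text{-}\mathbf{AxDec}_R$; i.e. $\tau_{i,\chi}(a_j)=a_{\pi_{i,\chi}(j)}$ and $\tau_{i,\chi}(A^j_x)=A^{\pi_{i,\chi}(j)}_x$ for all $j\in\mathcal{I}$, $x\in X$. Of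 unique type with respect to $\mathcal{Y}$: the map $\alpha$ is injective, and for all $i\ne j$ in $\mathcal{I}$ there is at least one $\chi\in\mathcal{Y}$ with $\tau_{i,\chi}\ne\tau_{j,\chi}$. Universal Miyamoto group. Write ${}^{g}h:=ghg^{-1}$. For each $i\in\mathcal{I}$ let $\mathcal{Y}_i=\{t_{i,\chi}\mid\chi\in\mathcal{Y}\}$ be a copy of the group $\mathcal{Y}$, and let $\mathcal{U}=\bigcup_i\mathcal{Y}_i$. For $a=t_{i,\chi}\in\mathcal{U}$ write $\overline a=\tau_{i,\chi}$ and $R_{\overline a}:=\{(j,k)\in\mathcal{I}\times\mathcal{I}\mid{}^{\overline a}\tau_{j,\chi'}=\tau_{k,\chi'}\text{ for all }\chi'\in\mathcal{Y}\}$. Then $\widehat{\mathrm{Miy}}_{\mathcal{Y}}(A,\mathcal{I},\Omega)$ is the quotient of the free product of the groups $\mathcal{Y}_i$ ($i\in\mathcal{I}$) by the relations ${}^{a}t_{j,\chi'}=t_{k,\chi'}$ for all $a\in\mathcal{U}$, $(j,k)\in R_{\overline a}$, $\chi'\in\mathcal{Y}$. (It is considered for algebras that are Miyamoto-closed, i.e. for each $i,\chi$ there is a permutation $\pi_{i,\chi}$ of $\mathcal{I}$ with $\tau_{i,\chi}(A^j_g)=A^{\pi_{i,\chi}(j)}_g$ for all $j,g$; Miyamoto-stable implies Miyamoto-closed.) *)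

theory Defs
  imports "HOL-Algebra.Algebra"
begin

section \<open>Categories and functors\<close>

text \<open>Hom-sets need not be disjoint, so composition takes the three objects as arguments.\<close>

record ('o, 'm) cat =
  Ob :: "'o set"
  Hom :: "'o \<Rightarrow> 'o \<Rightarrow> 'm set"
  Id :: "'o \<Rightarrow> 'm"
  Comp :: "'o \<Rightarrow> 'o \<Rightarrow> 'o \<Rightarrow> 'm \<Rightarrow> 'm \<Rightarrow> 'm"

definition is_category :: "('o, 'm) cat \<Rightarrow> bool" where
  "is_category C \<longleftrightarrow>
     (\<forall>A\<in>Ob C. Id C A \<in> Hom C A A) \<and>
     (\<forall>A\<in>Ob C. \<forall>B\<in>Ob C. \<forall>D\<in>Ob C. \<forall>f\<in>Hom C A B. \<forall>g\<in>Hom C B D.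
        Comp C A B D g f \<in> Hom C A D) \<and>
     (\<forall>A\<in>Ob C. \<forall>B\<in>Ob C. \<forall>f\<in>Hom C A B.
        Comp C A A B f (Id C A) = f \<and> Comp C A B B (Id C B) f = f) \<and>
     (\<forall>A\<in>Ob C. \<forall>B\<in>Ob C. \<forall>D\<in>Ob C. \<forall>E\<in>Ob C.
        \<forall>f\<in>Hom C A B. \<forall>g\<in>Hom C B D. \<forall>h\<in>Hom C D E.
        Comp C A D E h (Comp C A B D g f) = Comp C A B E (Comp C B D E h g) f)"

definition is_automorphism :: "('o, 'm) cat \<Rightarrow> 'o \<Rightarrow> 'm \<Rightarrow> bool" where
  "is_automorphism C A f \<longleftrightarrow> A \<in> Ob C \<and> f \<in> Hom C A A \<and>
     (\<exists>g\<in>Hom C A A. Comp C A A A g f = Id C A \<and> Comp C A A A f g = Id C A)"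

definition full_subcategory :: "('o, 'm) cat \<Rightarrow> ('o \<Rightarrow> bool) \<Rightarrow> ('o, 'm) cat" where
  "full_subcategory C P = C\<lparr>Ob := {A \<in> Ob C. P A}\<rparr>"

definition is_functor ::
  "('o, 'm) cat \<Rightarrow> ('p, 'n) cat \<Rightarrow> ('o \<Rightarrow> 'p) \<Rightarrow> ('o \<Rightarrow> 'o \<Rightarrow> 'm \<Rightarrow> 'n) \<Rightarrow> bool" where
  "is_functor C D Fo Fm \<longleftrightarrow> is_category C \<and> is_category D \<and>
     (\<forall>A\<in>Ob C. Fo A \<in> Ob D) \<and>
     (\<forall>A\<in>Ob C. \<forall>B\<in>Ob C. \<forall>f\<in>Hom C A B. Fm A B f \<in> Hom D (Fo A) (Fo B)) \<and>
     (\<forall>A\<in>Ob C. Fm A A (Id C A) = Id D (Fo A)) \<and>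
     (\<forall>A\<in>Ob C. \<forall>B\<in>Ob C. \<forall>E\<in>Ob C. \<forall>f\<in>Hom C A B. \<forall>g\<in>Hom C B E.
        Fm A E (Comp C A B E g f) = Comp D (Fo A) (Fo B) (Fo E) (Fm B E g) (Fm A B f))"

text \<open>
  Here and below, functions between carrier sets are extensional (\<^const>\<open>undefined\<close> outside
  their domain), so that equality of HOL functions is equality of morphisms.
\<close>

definition Grp :: "('h monoid, 'h \<Rightarrow> 'h) cat" where
  "Grp = \<lparr>Ob = {G. group G},
          Hom = \<lambda>G H. hom G H \<inter> extensional (carrier G),
          Id = \<lambda>G. \<lambda>x\<in>carrier G. x,
          Comp = \<lambda>G H K g f. compose (carrier G) g f\<rparr>"

section \<open>Free products and quotients by relations\<close>

definition free_product_words :: "'i set \<Rightarrow> ('i \<Rightarrow> ('h, 'z) monoid_scheme) \<Rightarrow> ('i \<times> 'h) list set" where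
  "free_product_words I G = lists (SIGMA i:I. carrier (G i))"

text \<open>
  The congruence on words generated by multiplying adjacent letters of the same factor and by
  deleting the units of the factors.
\<close>

inductive free_product_cong ::
  "'i set \<Rightarrow> ('i \<Rightarrow> ('h, 'z) monoid_scheme) \<Rightarrow> ('i \<times> 'h) list \<Rightarrow> ('i \<times> 'h) list \<Rightarrow> bool"
  for I G where
  refl: "w \<in> free_product_words I G \<Longrightarrow> free_product_cong I G w w"
| sym: "free_product_cong I G u v \<Longrightarrow> free_product_cong I G v u"
| trans: "free_product_cong I G u v \<Longrightarrow> free_product_cong I G v w \<Longrightarrow> free_product_cong I G u w"
| append: "free_product_cong I G u u' \<Longrightarrow> free_product_cong I G v v' \<Longrightarrow>
    free_product_cong I G (u @ v) (u' @ v')"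
| mult: "i \<in> I \<Longrightarrow> x \<in> carrier (G i) \<Longrightarrow> y \<in> carrier (G i) \<Longrightarrow>
    free_product_cong I G [(i, x), (i, y)] [(i, x \<otimes>\<^bsub>G i\<^esub> y)]"
| one: "i \<in> I \<Longrightarrow> free_product_cong I G [(i, \<one>\<^bsub>G i\<^esub>)] []"

definition free_product_class ::
  "'i set \<Rightarrow> ('i \<Rightarrow> ('h, 'z) monoid_scheme) \<Rightarrow> ('i \<times> 'h) list \<Rightarrow> ('i \<times> 'h) list set" where
  "free_product_class I G w = {v. free_product_cong I G w v}"

definition free_product ::
  "'i set \<Rightarrow> ('i \<Rightarrow> ('h, 'z) monoid_scheme) \<Rightarrow> ('i \<times> 'h) list set monoid" where
  "free_product I G =
     \<lparr>carrier = free_product_class I G ` free_product_words I G,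
      monoid.mult = \<lambda>P Q. \<Union>u\<in>P. \<Union>v\<in>Q. free_product_class I G (u @ v),
      one = free_product_class I G []\<rparr>"

definition normal_closure :: "('h, 'z) monoid_scheme \<Rightarrow> 'h set \<Rightarrow> 'h set" where
  "normal_closure G S = \<Inter>{N. N \<lhd> G \<and> S \<subseteq> N}"

text \<open>For a set \<open>E\<close> of pairs \<open>(u, v)\<close>, the normal subgroup by which \<open>G\<close> is divided
  when the relations \<open>u = v\<close> are imposed.\<close>

definition relation_subgroup :: "('h, 'z) monoid_scheme \<Rightarrow> ('h \<times> 'h) set \<Rightarrow> 'h set" where
  "relation_subgroup G E = normal_closure G {u \<otimes>\<^bsub>G\<^esub> inv\<^bsub>G\<^esub> v | u v. (u, v) \<in> E}"

section \<open>Fusion laws, gradings and characters\<close>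

record 'x fusion =
  labels :: "'x set"
  fuse :: "'x \<Rightarrow> 'x \<Rightarrow> 'x set"

definition is_fusion_law :: "'x fusion \<Rightarrow> bool" where
  "is_fusion_law \<Phi> \<longleftrightarrow> (\<forall>x\<in>labels \<Phi>. \<forall>y\<in>labels \<Phi>. fuse \<Phi> x y \<subseteq> labels \<Phi>)"

definition is_fusion_unit :: "'x fusion \<Rightarrow> 'x \<Rightarrow> bool" where
  "is_fusion_unit \<Phi> e \<longleftrightarrow> e \<in> labels \<Phi> \<and>
     (\<forall>x\<in>labels \<Phi>. fuse \<Phi> e x \<subseteq> {x} \<and> fuse \<Phi> x e \<subseteq> {x})"

definition is_grading :: "'x fusion \<Rightarrow> ('g, 'z) monoid_scheme \<Rightarrow> ('x \<Rightarrow> 'g) \<Rightarrow> bool" where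
  "is_grading \<Phi> \<Gamma> \<xi> \<longleftrightarrow> \<xi> \<in> labels \<Phi> \<rightarrow> carrier \<Gamma> \<and>
     (\<forall>x\<in>labels \<Phi>. \<forall>y\<in>labels \<Phi>. \<forall>z\<in>fuse \<Phi> x y. \<xi> z = \<xi> x \<otimes>\<^bsub>\<Gamma>\<^esub> \<xi> y)"

definition character_group ::
  "('r, 'y) ring_scheme \<Rightarrow> ('g, 'z) monoid_scheme \<Rightarrow> ('g \<Rightarrow> 'r) monoid" where
  "character_group R \<Gamma> =
     \<lparr>carrier = hom \<Gamma> (units_of R) \<inter> extensional (carrier \<Gamma>),
      monoid.mult = \<lambda>\<chi> \<psi>. \<lambda>g\<in>carrier \<Gamma>. \<chi> g \<otimes>\<^bsub>R\<^esub> \<psi> g,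
      one = \<lambda>g\<in>carrier \<Gamma>. \<one>\<^bsub>R\<^esub>\<rparr>"

section \<open>Algebras and direct sum decompositions\<close>

text \<open>
  \<^locale>\<open>algebra\<close> of HOL-Algebra requires a commutative ring. Here the \<open>mult\<close> field of
  the module record is an arbitrary bilinear product and its \<open>one\<close> field is ignored.
\<close>

locale nonassoc_algebra = module R A for R :: "('r, 'y) ring_scheme" and A :: "('r, 'a, 'z) module_scheme" +
  assumes prod_closed:
      "\<lbrakk>a \<in> carrier A; b \<in> carrier A\<rbrakk> \<Longrightarrow> a \<otimes>\<^bsub>A\<^esub> b \<in> carrier A"
    and prod_l_distr:
      "\<lbrakk>a \<in> carrier A; b \<in> carrier A; c \<in> carrier A\<rbrakk> \<Longrightarrow>
        (a \<oplus>\<^bsub>A\<^esub> b) \<otimes>\<^bsub>A\<^esub> c = a \<otimes>\<^bsub>A\<^esub> c \<oplus>\<^bsub>A\<^esub> b \<otimes>\<^bsub>A\<^esub> c"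
    and prod_r_distr:
      "\<lbrakk>a \<in> carrier A; b \<in> carrier A; c \<in> carrier A\<rbrakk> \<Longrightarrow>
        a \<otimes>\<^bsub>A\<^esub> (b \<oplus>\<^bsub>A\<^esub> c) = a \<otimes>\<^bsub>A\<^esub> b \<oplus>\<^bsub>A\<^esub> a \<otimes>\<^bsub>A\<^esub> c"
    and smult_prod_l:
      "\<lbrakk>r \<in> carrier R; a \<in> carrier A; b \<in> carrier A\<rbrakk> \<Longrightarrow>
        (r \<odot>\<^bsub>A\<^esub> a) \<otimes>\<^bsub>A\<^esub> b = r \<odot>\<^bsub>A\<^esub> (a \<otimes>\<^bsub>A\<^esub> b)"
    and smult_prod_r:
      "\<lbrakk>r \<in> carrier R; a \<in> carrier A; b \<in> carrier A\<rbrakk> \<Longrightarrow>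
        a \<otimes>\<^bsub>A\<^esub> (r \<odot>\<^bsub>A\<^esub> b) = r \<odot>\<^bsub>A\<^esub> (a \<otimes>\<^bsub>A\<^esub> b)"

definition module_hom ::
  "('r, 'y) ring_scheme \<Rightarrow> ('r, 'a) module \<Rightarrow> ('r, 'b) module \<Rightarrow> ('a \<Rightarrow> 'b) set" where
  "module_hom R A B = {f \<in> carrier A \<rightarrow>\<^sub>E carrier B.
     (\<forall>a\<in>carrier A. \<forall>b\<in>carrier A. f (a \<oplus>\<^bsub>A\<^esub> b) = f a \<oplus>\<^bsub>B\<^esub> f b) \<and>
     (\<forall>r\<in>carrier R. \<forall>a\<in>carrier A. f (r \<odot>\<^bsub>A\<^esub> a) = r \<odot>\<^bsub>B\<^esub> f a)}"

definition algebra_hom ::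
  "('r, 'y) ring_scheme \<Rightarrow> ('r, 'a) module \<Rightarrow> ('r, 'b) module \<Rightarrow> ('a \<Rightarrow> 'b) set" where
  "algebra_hom R A B = {f \<in> module_hom R A B.
     \<forall>a\<in>carrier A. \<forall>b\<in>carrier A. f (a \<otimes>\<^bsub>A\<^esub> b) = f a \<otimes>\<^bsub>B\<^esub> f b}"

definition algebra_Aut :: "('r, 'y) ring_scheme \<Rightarrow> ('r, 'a) module \<Rightarrow> ('a \<Rightarrow> 'a) monoid" where
  "algebra_Aut R A =
     BijGroup (carrier A) \<lparr>carrier := algebra_hom R A A \<inter> Bij (carrier A)\<rparr>"

text \<open>Index sets may be infinite: sums of submodules consist of finite sums of elements.\<close>

definition submodule_sum :: "('r, 'a) module \<Rightarrow> ('x \<Rightarrow> 'a set) \<Rightarrow> 'x set \<Rightarrow> 'a set" where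
  "submodule_sum A C Y = {finsum A f F | f F. finite F \<and> F \<subseteq> Y \<and> f \<in> (\<Pi> x\<in>F. C x)}"

definition is_direct_sum ::
  "('r, 'y) ring_scheme \<Rightarrow> ('r, 'a) module \<Rightarrow> 'x set \<Rightarrow> ('x \<Rightarrow> 'a set) \<Rightarrow> bool" where
  "is_direct_sum R A L C \<longleftrightarrow> (\<forall>x\<in>L. submodule (C x) R A) \<and>
     (\<forall>a\<in>carrier A. \<exists>!f. f \<in> (\<Pi>\<^sub>E x\<in>L. C x) \<and> finite {x \<in> L. f x \<noteq> \<zero>\<^bsub>A\<^esub>} \<and>
        a = finsum A f {x \<in> L. f x \<noteq> \<zero>\<^bsub>A\<^esub>})"

section \<open>Decomposition algebras\<close>

definition is_decomposition ::
  "('r, 'y) ring_scheme \<Rightarrow> 'x fusion \<Rightarrow> ('r, 'a) module \<Rightarrow> ('x \<Rightarrow> 'a set) \<Rightarrow> bool" where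
  "is_decomposition R \<Phi> A C \<longleftrightarrow> is_direct_sum R A (labels \<Phi>) C \<and>
     (\<forall>x\<in>labels \<Phi>. \<forall>y\<in>labels \<Phi>. \<forall>a\<in>C x. \<forall>b\<in>C y.
        a \<otimes>\<^bsub>A\<^esub> b \<in> submodule_sum A C (fuse \<Phi> x y))"

record ('r, 'a, 'i, 'x) dec_algebra =
  alg :: "('r, 'a) module"
  idx :: "'i set"
  component :: "'i \<Rightarrow> 'x \<Rightarrow> 'a set"

definition is_dec_algebra ::
  "('r, 'y) ring_scheme \<Rightarrow> 'x fusion \<Rightarrow> ('r, 'a, 'i, 'x, 'z) dec_algebra_scheme \<Rightarrow> bool" where
  "is_dec_algebra R \<Phi> D \<longleftrightarrow> nonassoc_algebra R (alg D) \<and>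
     (\<forall>i\<in>idx D. is_decomposition R \<Phi> (alg D) (component D i))"

definition dec_algebra_hom ::
  "('r, 'y) ring_scheme \<Rightarrow> 'x fusion \<Rightarrow> ('r, 'a, 'i, 'x, 'z) dec_algebra_scheme \<Rightarrow>
   ('r, 'b, 'j, 'x, 'w) dec_algebra_scheme \<Rightarrow> (('a \<Rightarrow> 'b) \<times> ('i \<Rightarrow> 'j)) set" where
  "dec_algebra_hom R \<Phi> D E = {(\<phi>, \<psi>). \<phi> \<in> algebra_hom R (alg D) (alg E) \<and>
     \<psi> \<in> idx D \<rightarrow>\<^sub>E idx E \<and>
     (\<forall>i\<in>idx D. \<forall>x\<in>labels \<Phi>. \<phi> ` component D i x \<subseteq> component E (\<psi> i) x)}"

section \<open>Axial decomposition algebras\<close>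

record ('r, 'a, 'i, 'x) axdec_algebra = "('r, 'a, 'i, 'x) dec_algebra" +
  axis :: "'i \<Rightarrow> 'a"

definition is_axdec_algebra ::
  "('r, 'y) ring_scheme \<Rightarrow> 'x fusion \<Rightarrow> 'x \<Rightarrow> ('x \<Rightarrow> 'r) \<Rightarrow> ('r, 'a, 'i, 'x) axdec_algebra \<Rightarrow> bool" where
  "is_axdec_algebra R \<Phi> e lam D \<longleftrightarrow> is_dec_algebra R \<Phi> D \<and>
     (\<forall>i\<in>idx D. axis D i \<in> component D i e \<and> axis D i \<noteq> \<zero>\<^bsub>alg D\<^esub> \<and>
        (\<forall>x\<in>labels \<Phi>. \<forall>b\<in>component D i x. axis D i \<otimes>\<^bsub>alg D\<^esub> b = lam x \<odot>\<^bsub>alg D\<^esub> b))"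

definition axdec_hom ::
  "('r, 'y) ring_scheme \<Rightarrow> 'x fusion \<Rightarrow> ('r, 'a, 'i, 'x) axdec_algebra \<Rightarrow>
   ('r, 'b, 'j, 'x) axdec_algebra \<Rightarrow> (('a \<Rightarrow> 'b) \<times> ('i \<Rightarrow> 'j)) set" where
  "axdec_hom R \<Phi> D E = {(\<phi>, \<psi>). (\<phi>, \<psi>) \<in> dec_algebra_hom R \<Phi> D E \<and>
     (\<forall>i\<in>idx D. \<phi> (axis D i) = axis E (\<psi> i))}"

text \<open>The types \<open>'a\<close> and \<open>'i\<close> play the role of a universe: every algebra and every index set
  is carried by an arbitrary subset of them.\<close>

definition AxDec ::
  "('r, 'y) ring_scheme \<Rightarrow> 'x fusion \<Rightarrow> 'x \<Rightarrow> ('x \<Rightarrow> 'r) \<Rightarrow>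
   (('r, 'a, 'i, 'x) axdec_algebra, ('a \<Rightarrow> 'a) \<times> ('i \<Rightarrow> 'i)) cat" where
  "AxDec R \<Phi> e lam =
     \<lparr>Ob = {D. is_axdec_algebra R \<Phi> e lam D},
      Hom = axdec_hom R \<Phi>,
      Id = \<lambda>D. (\<lambda>a\<in>carrier (alg D). a, \<lambda>i\<in>idx D. i),
      Comp = \<lambda>D E F g f. (compose (carrier (alg D)) (fst g) (fst f), compose (idx D) (snd g) (snd f))\<rparr>"

section \<open>Miyamoto maps\<close>

definition graded_comp ::
  "'x fusion \<Rightarrow> ('x \<Rightarrow> 'g) \<Rightarrow> ('r, 'a, 'i, 'x, 'z) dec_algebra_scheme \<Rightarrow> 'i \<Rightarrow> 'g \<Rightarrow> 'a set" where
  "graded_comp \<Phi> \<xi> D i g = submodule_sum (alg D) (component D i) {x \<in> labels \<Phi>. \<xi> x = g}"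

definition miyamoto_map ::
  "('r, 'y) ring_scheme \<Rightarrow> 'x fusion \<Rightarrow> ('g, 'w) monoid_scheme \<Rightarrow> ('x \<Rightarrow> 'g) \<Rightarrow>
   ('r, 'a, 'i, 'x, 'z) dec_algebra_scheme \<Rightarrow> 'i \<Rightarrow> ('g \<Rightarrow> 'r) \<Rightarrow> 'a \<Rightarrow> 'a" where
  "miyamoto_map R \<Phi> \<Gamma> \<xi> D i \<chi> = (THE \<tau>. \<tau> \<in> module_hom R (alg D) (alg D) \<and>
     (\<forall>g\<in>carrier \<Gamma>. \<forall>a\<in>graded_comp \<Phi> \<xi> D i g. \<tau> a = \<chi> g \<odot>\<^bsub>alg D\<^esub> a))"

definition miyamoto_stable ::
  "('r, 'y) ring_scheme \<Rightarrow> 'x fusion \<Rightarrow> 'x \<Rightarrow> ('x \<Rightarrow> 'r) \<Rightarrow> ('g, 'w) monoid_scheme \<Rightarrow> ('x \<Rightarrow> 'g) \<Rightarrow>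
   ('g \<Rightarrow> 'r) set \<Rightarrow> ('r, 'a, 'i, 'x) axdec_algebra \<Rightarrow> bool" where
  "miyamoto_stable R \<Phi> e lam \<Gamma> \<xi> Y D \<longleftrightarrow>
     (\<forall>i\<in>idx D. \<forall>\<chi>\<in>Y. \<exists>\<pi>\<in>Bij (idx D).
        is_automorphism (AxDec R \<Phi> e lam) D (miyamoto_map R \<Phi> \<Gamma> \<xi> D i \<chi>, \<pi>))"

definition unique_type ::
  "('r, 'y) ring_scheme \<Rightarrow> 'x fusion \<Rightarrow> ('g, 'w) monoid_scheme \<Rightarrow> ('x \<Rightarrow> 'g) \<Rightarrow>
   ('g \<Rightarrow> 'r) set \<Rightarrow> ('r, 'a, 'i, 'x) axdec_algebra \<Rightarrow> bool" where
  "unique_type R \<Phi> \<Gamma> \<xi> Y D \<longleftrightarrow> inj_on (axis D) (idx D) \<and>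
     (\<forall>i\<in>idx D. \<forall>j\<in>idx D. i \<noteq> j \<longrightarrow>
        (\<exists>\<chi>\<in>Y. miyamoto_map R \<Phi> \<Gamma> \<xi> D i \<chi> \<noteq> miyamoto_map R \<Phi> \<Gamma> \<xi> D j \<chi>))"

definition stable_unique_AxDec ::
  "('r, 'y) ring_scheme \<Rightarrow> 'x fusion \<Rightarrow> 'x \<Rightarrow> ('x \<Rightarrow> 'r) \<Rightarrow> ('g, 'w) monoid_scheme \<Rightarrow> ('x \<Rightarrow> 'g) \<Rightarrow>
   ('g \<Rightarrow> 'r) set \<Rightarrow> (('r, 'a, 'i, 'x) axdec_algebra, ('a \<Rightarrow> 'a) \<times> ('i \<Rightarrow> 'i)) cat" where
  "stable_unique_AxDec R \<Phi> e lam \<Gamma> \<xi> Y = full_subcategory (AxDec R \<Phi> e lam)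
     (\<lambda>D. miyamoto_stable R \<Phi> e lam \<Gamma> \<xi> Y D \<and> unique_type R \<Phi> \<Gamma> \<xi> Y D)"

section \<open>The universal Miyamoto group\<close>

text \<open>For \<open>\<theta>\<close> the Miyamoto map of a symbol \<open>t\<close>, these are the pairs \<open>(j, k)\<close> for which
  conjugation by \<open>t\<close> is required to take the \<open>j\<close>-th factor of the free product to the \<open>k\<close>-th.\<close>

definition conj_pairs ::
  "('r, 'y) ring_scheme \<Rightarrow> 'x fusion \<Rightarrow> ('g, 'w) monoid_scheme \<Rightarrow> ('x \<Rightarrow> 'g) \<Rightarrow>
   ('g \<Rightarrow> 'r) set \<Rightarrow> ('r, 'a, 'i, 'x, 'z) dec_algebra_scheme \<Rightarrow> ('a \<Rightarrow> 'a) \<Rightarrow> ('i \<times> 'i) set" where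
  "conj_pairs R \<Phi> \<Gamma> \<xi> Y D \<theta> = {(j, k). j \<in> idx D \<and> k \<in> idx D \<and>
     (\<forall>\<chi>'\<in>Y. \<theta> \<otimes>\<^bsub>algebra_Aut R (alg D)\<^esub> miyamoto_map R \<Phi> \<Gamma> \<xi> D j \<chi>'
        \<otimes>\<^bsub>algebra_Aut R (alg D)\<^esub> inv\<^bsub>algebra_Aut R (alg D)\<^esub> \<theta> = miyamoto_map R \<Phi> \<Gamma> \<xi> D k \<chi>')}"

definition miy_free_product ::
  "('r, 'y) ring_scheme \<Rightarrow> ('g, 'w) monoid_scheme \<Rightarrow>
   ('g \<Rightarrow> 'r) set \<Rightarrow> ('r, 'a, 'i, 'x, 'z) dec_algebra_scheme \<Rightarrow> ('i \<times> ('g \<Rightarrow> 'r)) list set monoid" where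
  "miy_free_product R \<Gamma> Y D =
     free_product (idx D) (\<lambda>i. (character_group R \<Gamma>)\<lparr>carrier := Y\<rparr>)"

definition miy_letter ::
  "('r, 'y) ring_scheme \<Rightarrow> ('g, 'w) monoid_scheme \<Rightarrow> ('g \<Rightarrow> 'r) set \<Rightarrow>
   ('r, 'a, 'i, 'x, 'z) dec_algebra_scheme \<Rightarrow> 'i \<Rightarrow> ('g \<Rightarrow> 'r) \<Rightarrow> ('i \<times> ('g \<Rightarrow> 'r)) list set" where
  "miy_letter R \<Gamma> Y D i \<chi> =
     free_product_class (idx D) (\<lambda>i. (character_group R \<Gamma>)\<lparr>carrier := Y\<rparr>) [(i, \<chi>)]"

definition miy_relations ::
  "('r, 'y) ring_scheme \<Rightarrow> 'x fusion \<Rightarrow> ('g, 'w) monoid_scheme \<Rightarrow> ('x \<Rightarrow> 'g) \<Rightarrow>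
   ('g \<Rightarrow> 'r) set \<Rightarrow> ('r, 'a, 'i, 'x, 'z) dec_algebra_scheme \<Rightarrow>
   (('i \<times> ('g \<Rightarrow> 'r)) list set \<times> ('i \<times> ('g \<Rightarrow> 'r)) list set) set" where
  "miy_relations R \<Phi> \<Gamma> \<xi> Y D =
     (let P = miy_free_product R \<Gamma> Y D; t = miy_letter R \<Gamma> Y D in
      {(t i \<chi> \<otimes>\<^bsub>P\<^esub> t j \<chi>' \<otimes>\<^bsub>P\<^esub> inv\<^bsub>P\<^esub> (t i \<chi>), t k \<chi>') | i \<chi> j k \<chi>'.
         i \<in> idx D \<and> \<chi> \<in> Y \<and> \<chi>' \<in> Y \<and>
         (j, k) \<in> conj_pairs R \<Phi> \<Gamma> \<xi> Y D (miyamoto_map R \<Phi> \<Gamma> \<xi> D i \<chi>)})"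

definition miy_kernel ::
  "('r, 'y) ring_scheme \<Rightarrow> 'x fusion \<Rightarrow> ('g, 'w) monoid_scheme \<Rightarrow> ('x \<Rightarrow> 'g) \<Rightarrow>
   ('g \<Rightarrow> 'r) set \<Rightarrow> ('r, 'a, 'i, 'x, 'z) dec_algebra_scheme \<Rightarrow> ('i \<times> ('g \<Rightarrow> 'r)) list set set" where
  "miy_kernel R \<Phi> \<Gamma> \<xi> Y D =
     relation_subgroup (miy_free_product R \<Gamma> Y D) (miy_relations R \<Phi> \<Gamma> \<xi> Y D)"

definition Miy_hat ::
  "('r, 'y) ring_scheme \<Rightarrow> 'x fusion \<Rightarrow> ('g, 'w) monoid_scheme \<Rightarrow> ('x \<Rightarrow> 'g) \<Rightarrow>
   ('g \<Rightarrow> 'r) set \<Rightarrow> ('r, 'a, 'i, 'x, 'z) dec_algebra_scheme \<Rightarrow>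
   ('i \<times> ('g \<Rightarrow> 'r)) list set set monoid" where
  "Miy_hat R \<Phi> \<Gamma> \<xi> Y D = miy_free_product R \<Gamma> Y D Mod miy_kernel R \<Phi> \<Gamma> \<xi> Y D"

text \<open>\<^term>\<open>miy_letter R \<Gamma> Y D i \<chi>\<close> is the symbol of \<open>(i, \<chi>)\<close> in the free product;
  the following is its image in the quotient.\<close>

definition miy_gen ::
  "('r, 'y) ring_scheme \<Rightarrow> 'x fusion \<Rightarrow> ('g, 'w) monoid_scheme \<Rightarrow> ('x \<Rightarrow> 'g) \<Rightarrow>
   ('g \<Rightarrow> 'r) set \<Rightarrow> ('r, 'a, 'i, 'x, 'z) dec_algebra_scheme \<Rightarrow> 'i \<Rightarrow> ('g \<Rightarrow> 'r) \<Rightarrow>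
   ('i \<times> ('g \<Rightarrow> 'r)) list set set" where
  "miy_gen R \<Phi> \<Gamma> \<xi> Y D i \<chi> =
     miy_kernel R \<Phi> \<Gamma> \<xi> Y D #>\<^bsub>miy_free_product R \<Gamma> Y D\<^esub> miy_letter R \<Gamma> Y D i \<chi>"

definition is_Miy_hat_map ::
  "('r, 'y) ring_scheme \<Rightarrow> 'x fusion \<Rightarrow> ('g, 'w) monoid_scheme \<Rightarrow> ('x \<Rightarrow> 'g) \<Rightarrow>
   ('g \<Rightarrow> 'r) set \<Rightarrow> ('r, 'a, 'i, 'x) axdec_algebra \<Rightarrow> ('r, 'a, 'i, 'x) axdec_algebra \<Rightarrow>
   ('a \<Rightarrow> 'a) \<times> ('i \<Rightarrow> 'i) \<Rightarrow>
   (('i \<times> ('g \<Rightarrow> 'r)) list set set \<Rightarrow> ('i \<times> ('g \<Rightarrow> 'r)) list set set) \<Rightarrow> bool" where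
  "is_Miy_hat_map R \<Phi> \<Gamma> \<xi> Y D E f h \<longleftrightarrow>
     h \<in> Hom Grp (Miy_hat R \<Phi> \<Gamma> \<xi> Y D) (Miy_hat R \<Phi> \<Gamma> \<xi> Y E) \<and>
     (\<forall>i\<in>idx D. \<forall>\<chi>\<in>Y. h (miy_gen R \<Phi> \<Gamma> \<xi> Y D i \<chi>) = miy_gen R \<Phi> \<Gamma> \<xi> Y E (snd f i) \<chi>)"

definition Miy_hat_map ::
  "('r, 'y) ring_scheme \<Rightarrow> 'x fusion \<Rightarrow> ('g, 'w) monoid_scheme \<Rightarrow> ('x \<Rightarrow> 'g) \<Rightarrow>
   ('g \<Rightarrow> 'r) set \<Rightarrow> ('r, 'a, 'i, 'x) axdec_algebra \<Rightarrow> ('r, 'a, 'i, 'x) axdec_algebra \<Rightarrow>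
   ('a \<Rightarrow> 'a) \<times> ('i \<Rightarrow> 'i) \<Rightarrow>
   ('i \<times> ('g \<Rightarrow> 'r)) list set set \<Rightarrow> ('i \<times> ('g \<Rightarrow> 'r)) list set set" where
  "Miy_hat_map R \<Phi> \<Gamma> \<xi> Y D E f = (THE h. is_Miy_hat_map R \<Phi> \<Gamma> \<xi> Y D E f h)"

end

theory Submission
  imports Defs
begin

text \<open>
  By its presentation, a homomorphism out of the universal Miyamoto group of \<open>D\<close> is prescribed on
  the symbols \<open>t\<^sub>i\<^sub>,\<^sub>\<chi>\<close>, subject to multiplicativity in \<open>\<chi>\<close> and to the conjugation relations.
  Uniqueness of the map induced by \<open>(\<phi>, \<psi>)\<close>, and from it compatibility with identities and
  composition, is then immediate. All the content lies in one question: when \<open>(j, k)\<close> is a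
  conjugation pair for \<open>\<tau>\<^sub>i\<^sub>,\<^sub>\<chi>\<close> in \<open>D\<close>, is \<open>(\<psi> j, \<psi> k)\<close> one for \<open>\<tau>\<^sub>\<psi>\<^sub>i\<^sub>,\<^sub>\<chi>\<close> in \<open>E\<close>?
  As \<open>\<phi>\<close> may fail to be surjective, an identity between automorphisms of the algebra of \<open>D\<close>
  says nothing by itself about automorphisms of the algebra of \<open>E\<close>.

  The way out is to translate the pairs into a condition on axes, which morphisms do preserve.
  The key is that Miyamoto maps are natural, \<open>\<phi> \<circ> \<tau>\<^sub>i\<^sub>,\<^sub>\<chi> = \<tau>\<^sub>\<psi>\<^sub>i\<^sub>,\<^sub>\<chi> \<circ> \<phi>\<close>, since \<open>\<phi>\<close> maps
  components to components (\<open>miyamoto_map_natural\<close>). By stability \<open>\<tau>\<^sub>i\<^sub>,\<^sub>\<chi>\<close> is itself the algebra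
  part of an automorphism \<open>(\<tau>\<^sub>i\<^sub>,\<^sub>\<chi>, \<pi>)\<close>, and naturality applied to that automorphism shows that
  conjugation by \<open>\<tau>\<^sub>i\<^sub>,\<^sub>\<chi>\<close> takes \<open>\<tau>\<^sub>j\<^sub>,\<^sub>\<chi>\<^sub>'\<close> to \<open>\<tau>\<^sub>\<pi>\<^sub>j\<^sub>,\<^sub>\<chi>\<^sub>'\<close>. Unique type, in its two halves, turns
  the requirement that these be the \<open>\<tau>\<^sub>k\<^sub>,\<^sub>\<chi>\<^sub>'\<close> into \<open>\<pi> j = k\<close>, and this into
  \<open>\<tau>\<^sub>i\<^sub>,\<^sub>\<chi> a\<^sub>j = a\<^sub>k\<close> (\<open>conj_pairs_iff_axis\<close>). Applying \<open>\<phi>\<close> to the last equation and using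
  naturality once more gives the same equation between axes of \<open>E\<close> (\<open>conj_pairs_mono\<close>).
\<close>

section \<open>Free products of groups\<close>

locale group_family =
  fixes I :: "'i set" and G :: "'i \<Rightarrow> ('h, 'z) monoid_scheme"
  assumes group_factor: "i \<in> I \<Longrightarrow> group (G i)"
begin

lemma words_simps [simp]:
  "[] \<in> free_product_words I G"
  "(i, x) # w \<in> free_product_words I G \<longleftrightarrow> i \<in> I \<and> x \<in> carrier (G i) \<and> w \<in> free_product_words I G"
  "u @ v \<in> free_product_words I G \<longleftrightarrow> u \<in> free_product_words I G \<and> v \<in> free_product_words I G"
  by (auto simp: free_product_words_def)

lemma cong_words:
  "free_product_cong I G u v \<Longrightarrow> u \<in> free_product_words I G \<and> v \<in> free_product_words I G"
  by (induction rule: free_product_cong.induct)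
    (auto simp: monoid.m_closed monoid.one_closed group.is_monoid group_factor)

lemma class_eq_iff:
  assumes "u \<in> free_product_words I G"
  shows "free_product_class I G u = free_product_class I G v \<longleftrightarrow> free_product_cong I G u v"
  using assms unfolding free_product_class_def
  by (blast intro: free_product_cong.refl free_product_cong.sym free_product_cong.trans)

lemma class_closed [simp]:
  "w \<in> free_product_words I G \<Longrightarrow> free_product_class I G w \<in> carrier (free_product I G)"
  by (simp add: free_product_def)

lemma carrier_cases:
  assumes "P \<in> carrier (free_product I G)"
  obtains w where "w \<in> free_product_words I G" "P = free_product_class I G w"
  using assms by (auto simp: free_product_def)

lemma one_class: "\<one>\<^bsub>free_product I G\<^esub> = free_product_class I G []"
  by (simp add: free_product_def)

lemma mult_class:
  assumes u: "u \<in> free_product_words I G" and v: "v \<in> free_product_words I G"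
  shows "free_product_class I G u \<otimes>\<^bsub>free_product I G\<^esub> free_product_class I G v
    = free_product_class I G (u @ v)"
proof -
  have "free_product_class I G (u' @ v') = free_product_class I G (u @ v)"
    if "u' \<in> free_product_class I G u" "v' \<in> free_product_class I G v" for u' v'
  proof -
    have "free_product_cong I G (u @ v) (u' @ v')"
      using that by (auto simp: free_product_class_def intro: free_product_cong.append)
    then show ?thesis
      using u v by (metis class_eq_iff words_simps(3))
  qed
  moreover have "u \<in> free_product_class I G u" "v \<in> free_product_class I G v"
    using u v by (auto simp: free_product_class_def intro: free_product_cong.refl)
  ultimately have "(\<Union>u'\<in>free_product_class I G u. \<Union>v'\<in>free_product_class I G v.
      free_product_class I G (u' @ v')) = free_product_class I G (u @ v)"
    by blast
  then show ?thesis by (simp add: free_product_def)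
qed

lemma mult_class_letters:
  assumes "i \<in> I" "x \<in> carrier (G i)" "y \<in> carrier (G i)"
  shows "free_product_class I G [(i, x)] \<otimes>\<^bsub>free_product I G\<^esub> free_product_class I G [(i, y)]
    = free_product_class I G [(i, x \<otimes>\<^bsub>G i\<^esub> y)]"
proof -
  have "free_product_class I G ([(i, x)] @ [(i, y)]) = free_product_class I G [(i, x \<otimes>\<^bsub>G i\<^esub> y)]"
    using assms by (simp add: class_eq_iff free_product_cong.mult)
  with assms show ?thesis by (simp add: mult_class)
qed

text \<open>
  The unit and multiplication rules together cancel an adjacent pair of inverse letters, so the
  reversed word of inverse letters, built here by recursion on \<open>w\<close>, is an inverse of \<open>w\<close>.
\<close>

lemma left_inverse_word:
  assumes "w \<in> free_product_words I G"
  shows "\<exists>v \<in> free_product_words I G. free_product_cong I G (v @ w) []"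
  using assms
proof (induction w)
  case Nil
  show ?case by (rule bexI[of _ "[]"]) (auto intro: free_product_cong.refl)
next
  case (Cons a w)
  obtain i x where a: "a = (i, x)" by fastforce
  with Cons.prems have ix: "i \<in> I" "x \<in> carrier (G i)" and w: "w \<in> free_product_words I G" by auto
  interpret Gi: group "G i" by (rule group_factor) fact
  let ?x' = "inv\<^bsub>G i\<^esub> x"
  obtain v where v: "v \<in> free_product_words I G" "free_product_cong I G (v @ w) []"
    using Cons.IH w by blast
  have "free_product_cong I G [(i, ?x'), (i, x)] [(i, ?x' \<otimes>\<^bsub>G i\<^esub> x)]"
    using ix by (intro free_product_cong.mult) auto
  moreover have "free_product_cong I G [(i, ?x' \<otimes>\<^bsub>G i\<^esub> x)] []"
    using ix by (simp add: free_product_cong.one)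
  ultimately have "free_product_cong I G [(i, ?x'), (i, x)] []"
    by (rule free_product_cong.trans)
  then have "free_product_cong I G (v @ [(i, ?x'), (i, x)] @ w) (v @ [] @ w)"
    using v w by (intro free_product_cong.append) (auto intro: free_product_cong.refl)
  then have "free_product_cong I G ((v @ [(i, ?x')]) @ a # w) []"
    using v(2) a by (auto intro: free_product_cong.trans)
  then show ?case
    using v ix by (intro bexI[of _ "v @ [(i, ?x')]"]) auto
qed

sublocale free_product: group "free_product I G"
proof (rule groupI)
  fix P assume "P \<in> carrier (free_product I G)"
  then obtain w where w: "w \<in> free_product_words I G" "P = free_product_class I G w"
    by (rule carrier_cases)
  then show "\<one>\<^bsub>free_product I G\<^esub> \<otimes>\<^bsub>free_product I G\<^esub> P = P"
    by (simp add: one_class mult_class)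
  obtain v where "v \<in> free_product_words I G" "free_product_cong I G (v @ w) []"
    using left_inverse_word w(1) by blast
  then show "\<exists>Q\<in>carrier (free_product I G). Q \<otimes>\<^bsub>free_product I G\<^esub> P = \<one>\<^bsub>free_product I G\<^esub>"
    using w by (intro bexI[of _ "free_product_class I G v"]) (auto simp: one_class mult_class class_eq_iff)
next
  fix P Q S assume "P \<in> carrier (free_product I G)" "Q \<in> carrier (free_product I G)"
    "S \<in> carrier (free_product I G)"
  then show "P \<otimes>\<^bsub>free_product I G\<^esub> Q \<otimes>\<^bsub>free_product I G\<^esub> S
      = P \<otimes>\<^bsub>free_product I G\<^esub> (Q \<otimes>\<^bsub>free_product I G\<^esub> S)"
    by (elim carrier_cases) (simp add: mult_class)
qed (auto simp: one_class mult_class elim!: carrier_cases)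

text \<open>
  Every class is a product of classes of one-letter words, so a homomorphism is determined by its
  values on the letters.
\<close>

lemma hom_eqI:
  assumes "group H" and h: "h \<in> hom (free_product I G) H" and k: "k \<in> hom (free_product I G) H"
    and eq: "\<And>i x. \<lbrakk>i \<in> I; x \<in> carrier (G i)\<rbrakk> \<Longrightarrow>
      h (free_product_class I G [(i, x)]) = k (free_product_class I G [(i, x)])"
    and P: "P \<in> carrier (free_product I G)"
  shows "h P = k P"
proof -
  have one: "h \<one>\<^bsub>free_product I G\<^esub> = k \<one>\<^bsub>free_product I G\<^esub>"
    using hom_one[OF h] hom_one[OF k] \<open>group H\<close> free_product.is_group by simp
  have "h (free_product_class I G w) = k (free_product_class I G w)"
    if "w \<in> free_product_words I G" for w
    using that
  proof (induction w)
    case Nil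
    show ?case using one by (simp add: one_class)
  next
    case (Cons a w)
    obtain i x where a: "a = (i, x)" by fastforce
    have split: "free_product_class I G (a # w)
      = free_product_class I G [(i, x)] \<otimes>\<^bsub>free_product I G\<^esub> free_product_class I G w"
      using Cons.prems a by (simp add: mult_class)
    show ?case
      unfolding split using Cons a eq hom_mult[OF h] hom_mult[OF k] by simp
  qed
  then show ?thesis using carrier_cases[OF P] by metis
qed

text \<open>
  The universal property of the free product: multiplying out the images of the letters of a word
  respects each of the rules that generate the congruence.
\<close>

lemma hom_exists:
  assumes "group H" and f: "\<And>i. i \<in> I \<Longrightarrow> f i \<in> hom (G i) H"
  obtains h where "h \<in> hom (free_product I G) H"
    and "\<And>i x. \<lbrakk>i \<in> I; x \<in> carrier (G i)\<rbrakk> \<Longrightarrow> h (free_product_class I G [(i, x)]) = f i x"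
proof -
  interpret H: group H by fact
  define ev where "ev = (\<lambda>w. foldr (\<lambda>(i, x) a. f i x \<otimes>\<^bsub>H\<^esub> a) w \<one>\<^bsub>H\<^esub>)"
  have ev_simps [simp]: "ev [] = \<one>\<^bsub>H\<^esub>" "ev ((i, x) # w) = f i x \<otimes>\<^bsub>H\<^esub> ev w" for i x w
    by (auto simp: ev_def)
  have f_closed [simp]: "f i x \<in> carrier H" if "i \<in> I" "x \<in> carrier (G i)" for i x
    using f that by (auto simp: hom_def)
  have ev_closed [simp]: "ev w \<in> carrier H" if "w \<in> free_product_words I G" for w
    using that by (induction w) auto
  have ev_append: "ev (u @ v) = ev u \<otimes>\<^bsub>H\<^esub> ev v"
    if "u \<in> free_product_words I G" "v \<in> free_product_words I G" for u v
    using that by (induction u) (auto simp: H.m_assoc)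
  have ev_cong: "free_product_cong I G u v \<Longrightarrow> ev u = ev v" for u v
  proof (induction rule: free_product_cong.induct)
    case (append u u' v v')
    then show ?case using cong_words[of u u'] cong_words[of v v'] by (simp add: ev_append)
  next
    case (mult i x y)
    then show ?case
      using hom_mult[OF f] H.m_assoc by simp
  next
    case (one i)
    then show ?case
      using hom_one[OF f group_factor] H.is_group by simp
  qed auto
  \<comment> \<open>Elements of the free product are classes of words, on which the product \<open>ev\<close> is constant;
       its value is read off from the image of the class.\<close>
  define h where "h = (\<lambda>P. the_elem (ev ` P))"
  have h_class: "h (free_product_class I G w) = ev w" if "w \<in> free_product_words I G" for w
  proof -
    have "w \<in> free_product_class I G w"
      using that by (simp add: free_product_class_def free_product_cong.refl)
    moreover have "ev v = ev w" if "v \<in> free_product_class I G w" for v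
      using that ev_cong[of w v] by (simp add: free_product_class_def)
    ultimately have "ev ` free_product_class I G w = {ev w}"
      by blast
    then show ?thesis by (simp add: h_def)
  qed
  show thesis
  proof
    show "h \<in> hom (free_product I G) H"
    proof (rule homI)
      fix P assume "P \<in> carrier (free_product I G)"
      then show "h P \<in> carrier H" by (auto elim!: carrier_cases simp: h_class)
    next
      fix P Q assume "P \<in> carrier (free_product I G)" "Q \<in> carrier (free_product I G)"
      then show "h (P \<otimes>\<^bsub>free_product I G\<^esub> Q) = h P \<otimes>\<^bsub>H\<^esub> h Q"
        by (auto elim!: carrier_cases simp: h_class mult_class ev_append)
    qed
  qed (simp add: h_class)
qed

end

section \<open>Imposing relations\<close>

text \<open>
  The whole group is one of the normal subgroups that are intersected. This is what keeps the
  intersection from being the universal set.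
\<close>

lemma (in group) normal_normal_closure:
  assumes "S \<subseteq> carrier G"
  shows "normal_closure G S \<lhd> G"
proof -
  let ?F = "{N. N \<lhd> G \<and> S \<subseteq> N}"
  have "carrier G \<lhd> G"
    by (simp add: normal_inv_iff subgroup_self)
  with assms have ne: "?F \<noteq> {}" by blast
  have "subgroup (\<Inter>?F) G"
    using ne by (intro subgroups_Inter) (auto intro: normal_imp_subgroup)
  moreover have "\<forall>x\<in>carrier G. \<forall>h\<in>\<Inter>?F. x \<otimes> h \<otimes> inv x \<in> \<Inter>?F"
  proof (intro ballI InterI)
    fix x h N assume "x \<in> carrier G" "h \<in> \<Inter>?F" "N \<in> ?F"
    then show "x \<otimes> h \<otimes> inv x \<in> N"
      by (intro normal.inv_op_closed2) auto
  qed
  ultimately show ?thesis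
    unfolding normal_closure_def normal_inv_iff by (rule conjI)
qed

lemma (in group) normal_relation_subgroup:
  assumes "E \<subseteq> carrier G \<times> carrier G"
  shows "relation_subgroup G E \<lhd> G"
  unfolding relation_subgroup_def using assms by (intro normal_normal_closure) auto

lemma (in group) relation_subgroup_rcos_eq:
  assumes E: "E \<subseteq> carrier G \<times> carrier G" and uv: "(u, v) \<in> E"
  shows "relation_subgroup G E #> u = relation_subgroup G E #> v"
proof -
  have N: "subgroup (relation_subgroup G E) G"
    using normal_relation_subgroup[OF E] by (rule normal_imp_subgroup)
  have "u \<otimes> inv v \<in> relation_subgroup G E"
    unfolding relation_subgroup_def normal_closure_def
  proof (intro InterI)
    fix N assume "N \<in> {N. N \<lhd> G \<and> {u \<otimes> inv v | u v. (u, v) \<in> E} \<subseteq> N}"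
    with uv show "u \<otimes> inv v \<in> N" by blast
  qed
  moreover have "u \<in> carrier G" "v \<in> carrier G" using E uv by auto
  ultimately have "u \<in> relation_subgroup G E #> v"
    using N by (intro subgroup.rcos_module_rev is_group)
  then show ?thesis
    using repr_independence[OF _ \<open>v \<in> carrier G\<close> N] by blast
qed

lemma (in group_hom) relation_subgroup_le_kernel:
  assumes "\<And>u v. (u, v) \<in> E \<Longrightarrow> u \<in> carrier G \<and> v \<in> carrier G \<and> h u = h v"
  shows "relation_subgroup G E \<subseteq> kernel G H h"
proof -
  have "u \<otimes>\<^bsub>G\<^esub> inv\<^bsub>G\<^esub> v \<in> kernel G H h" if "(u, v) \<in> E" for u v
    using assms[OF that] by (auto simp: kernel_def)
  then have "{u \<otimes>\<^bsub>G\<^esub> inv\<^bsub>G\<^esub> v | u v. (u, v) \<in> E} \<subseteq> kernel G H h"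
    by blast
  with normal_kernel show ?thesis
    unfolding relation_subgroup_def normal_closure_def by (intro Inter_lower CollectI conjI)
qed

section \<open>Linear maps on direct sums\<close>

lemma module_hom_closed:
  "f \<in> module_hom R A B \<Longrightarrow> a \<in> carrier A \<Longrightarrow> f a \<in> carrier B"
  by (auto simp: module_hom_def)

lemma module_hom_compose:
  assumes "f \<in> module_hom R A B" "g \<in> module_hom R B C"
    "module R A"
  shows "compose (carrier A) g f \<in> module_hom R A C"
proof -
  interpret module R A by fact
  show ?thesis
    using assms(1,2) by (auto simp: module_hom_def compose_def PiE_iff)
qed

lemma module_hom_zero:
  assumes "module R A" "module R B" "f \<in> module_hom R A B"
  shows "f \<zero>\<^bsub>A\<^esub> = \<zero>\<^bsub>B\<^esub>"
proof -
  interpret A: module R A by fact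
  interpret B: module R B by fact
  have "f (\<zero>\<^bsub>R\<^esub> \<odot>\<^bsub>A\<^esub> \<zero>\<^bsub>A\<^esub>) = \<zero>\<^bsub>R\<^esub> \<odot>\<^bsub>B\<^esub> f \<zero>\<^bsub>A\<^esub>"
    using assms(3) unfolding module_hom_def by blast
  then show ?thesis
    using module_hom_closed[OF assms(3)] by (simp add: A.smult_l_null B.smult_l_null)
qed

lemma module_hom_finsum:
  assumes "module R A" "module R B" "f \<in> module_hom R A B" "finite F" "c \<in> F \<rightarrow> carrier A"
  shows "f (finsum A c F) = finsum B (\<lambda>x. f (c x)) F"
proof -
  interpret A: module R A by fact
  interpret B: module R B by fact
  show ?thesis
    using assms(4,5)
  proof (induction F)
    case empty
    then show ?case using module_hom_zero[OF assms(1-3)] by simp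
  next
    case (insert x F)
    have "f (c x \<oplus>\<^bsub>A\<^esub> finsum A c F) = f (c x) \<oplus>\<^bsub>B\<^esub> f (finsum A c F)"
      using insert.prems assms(3) by (auto simp: module_hom_def)
    with insert show ?case
      by (simp add: Pi_def module_hom_closed[OF assms(3)])
  qed
qed

locale direct_sum = module R A for R :: "('r, 'y) ring_scheme" and A :: "('r, 'a) module" +
  fixes L :: "'x set" and C :: "'x \<Rightarrow> 'a set"
  assumes direct_sum: "is_direct_sum R A L C"
begin

definition coords :: "'a \<Rightarrow> 'x \<Rightarrow> 'a" where
  "coords a = (THE f. f \<in> (\<Pi>\<^sub>E x\<in>L. C x) \<and> finite {x \<in> L. f x \<noteq> \<zero>\<^bsub>A\<^esub>} \<and>
     a = finsum A f {x \<in> L. f x \<noteq> \<zero>\<^bsub>A\<^esub>})"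

definition supp :: "'a \<Rightarrow> 'x set" where
  "supp a = {x \<in> L. coords a x \<noteq> \<zero>\<^bsub>A\<^esub>}"

lemma submodule_summand: "x \<in> L \<Longrightarrow> submodule (C x) R A"
  using direct_sum by (simp add: is_direct_sum_def)

lemma summand_closed: "x \<in> L \<Longrightarrow> b \<in> C x \<Longrightarrow> b \<in> carrier A"
  using submoduleE(1)[OF submodule_summand] by blast

lemma summand_smult: "x \<in> L \<Longrightarrow> r \<in> carrier R \<Longrightarrow> b \<in> C x \<Longrightarrow> r \<odot>\<^bsub>A\<^esub> b \<in> C x"
  using submoduleE(4)[OF submodule_summand] by blast

lemma summand_add: "x \<in> L \<Longrightarrow> a \<in> C x \<Longrightarrow> b \<in> C x \<Longrightarrow> a \<oplus>\<^bsub>A\<^esub> b \<in> C x"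
  using submoduleE(5)[OF submodule_summand] by blast

lemma summand_zero: "x \<in> L \<Longrightarrow> \<zero>\<^bsub>A\<^esub> \<in> C x"
  using subgroup.one_closed[OF submodule.axioms(1)[OF submodule_summand]] by simp

lemma coords:
  assumes "a \<in> carrier A"
  shows "coords a \<in> (\<Pi>\<^sub>E x\<in>L. C x)" "finite (supp a)" "finsum A (coords a) (supp a) = a"
  using theI'[of "\<lambda>f. f \<in> (\<Pi>\<^sub>E x\<in>L. C x) \<and> finite {x \<in> L. f x \<noteq> \<zero>\<^bsub>A\<^esub>} \<and>
     a = finsum A f {x \<in> L. f x \<noteq> \<zero>\<^bsub>A\<^esub>}", folded coords_def, folded supp_def]
    assms direct_sum unfolding is_direct_sum_def by auto

lemma coords_summand: "a \<in> carrier A \<Longrightarrow> x \<in> L \<Longrightarrow> coords a x \<in> C x"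
  using coords(1) by (auto simp: PiE_iff)

lemma coords_closed [simp]: "a \<in> carrier A \<Longrightarrow> x \<in> L \<Longrightarrow> coords a x \<in> carrier A"
  using coords_summand summand_closed by blast

text \<open>
  The support of a sum can be smaller than the union of the supports, so comparing coordinates
  requires sums over larger finite sets of labels.
\<close>

lemma finsum_coords:
  assumes "a \<in> carrier A" "finite F" "supp a \<subseteq> F" "F \<subseteq> L"
  shows "finsum A (coords a) F = a"
proof -
  have "finsum A (coords a) F = finsum A (coords a) (supp a)"
    using assms by (intro add.finprod_mono_neutral_cong_right) (auto simp: supp_def subset_iff)
  then show ?thesis using coords(3)[OF assms(1)] by simp
qed

lemma coords_eqI:
  assumes f: "f \<in> (\<Pi>\<^sub>E x\<in>L. C x)" and F: "finite F" "F \<subseteq> L" "\<And>x. x \<in> L - F \<Longrightarrow> f x = \<zero>\<^bsub>A\<^esub>"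
  shows "coords (finsum A f F) = f"
proof -
  let ?a = "finsum A f F" and ?S = "{x \<in> L. f x \<noteq> \<zero>\<^bsub>A\<^esub>}"
  have fc: "f \<in> F \<rightarrow> carrier A"
    using f F(2) summand_closed by (auto simp: PiE_iff subset_iff)
  have S: "?S \<subseteq> F" using F(3) by auto
  have "?a = finsum A f ?S"
    using S F fc by (intro add.finprod_mono_neutral_cong_right) auto
  moreover have "finite ?S" using S F(1) by (rule finite_subset)
  moreover have "?a \<in> carrier A" using fc by (rule finsum_closed)
  ultimately show ?thesis
    using f direct_sum unfolding is_direct_sum_def coords_def by (intro the1_equality) auto
qed

lemma coords_add:
  assumes a: "a \<in> carrier A" and b: "b \<in> carrier A" and x: "x \<in> L"
  shows "coords (a \<oplus>\<^bsub>A\<^esub> b) x = coords a x \<oplus>\<^bsub>A\<^esub> coords b x"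
proof -
  let ?F = "supp a \<union> supp b" and ?f = "\<lambda>x\<in>L. coords a x \<oplus>\<^bsub>A\<^esub> coords b x"
  have F: "finite ?F" "?F \<subseteq> L" using coords(2) a b by (auto simp: supp_def)
  have "a \<oplus>\<^bsub>A\<^esub> b = finsum A (coords a) ?F \<oplus>\<^bsub>A\<^esub> finsum A (coords b) ?F"
    using a b F by (simp add: finsum_coords)
  also have "\<dots> = finsum A (\<lambda>x. coords a x \<oplus>\<^bsub>A\<^esub> coords b x) ?F"
    using a b F by (intro finsum_addf[symmetric]) auto
  also have "\<dots> = finsum A ?f ?F"
    using a b F by (intro finsum_cong') auto
  also have "coords \<dots> = ?f"
    using a b F by (intro coords_eqI) (auto simp: summand_add coords_summand supp_def)
  finally show ?thesis using x by simp
qed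

lemma coords_smult:
  assumes a: "a \<in> carrier A" and r: "r \<in> carrier R" and x: "x \<in> L"
  shows "coords (r \<odot>\<^bsub>A\<^esub> a) x = r \<odot>\<^bsub>A\<^esub> coords a x"
proof -
  let ?F = "supp a" and ?f = "\<lambda>x\<in>L. r \<odot>\<^bsub>A\<^esub> coords a x"
  have F: "finite ?F" "?F \<subseteq> L" using coords(2) a by (auto simp: supp_def)
  have "r \<odot>\<^bsub>A\<^esub> a = r \<odot>\<^bsub>A\<^esub> finsum A (coords a) ?F"
    using a F by (simp add: finsum_coords)
  also have "\<dots> = finsum A (\<lambda>x. r \<odot>\<^bsub>A\<^esub> coords a x) ?F"
    using a r F by (intro finsum_smult_ldistr) auto
  also have "\<dots> = finsum A ?f ?F"
    using a r F by (intro finsum_cong') auto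
  also have "coords \<dots> = ?f"
    using a r F by (intro coords_eqI) (auto simp: summand_smult coords_summand supp_def smult_r_null)
  finally show ?thesis using x by simp
qed

lemma coords_of_summand:
  assumes "x \<in> L" "b \<in> C x"
  shows "coords b = (\<lambda>y\<in>L. if y = x then b else \<zero>\<^bsub>A\<^esub>)" (is "_ = ?f")
proof -
  have "coords (finsum A ?f {x}) = ?f"
    using assms by (intro coords_eqI) (auto simp: summand_zero)
  moreover have "finsum A ?f {x} = b"
    using assms summand_closed by simp
  ultimately show ?thesis by simp
qed

text \<open>
  The summands generate the module: every element is the finite sum of its coordinates.
\<close>

lemma module_hom_eqI:
  assumes B: "module R B" and S: "S \<in> module_hom R A B" and T: "T \<in> module_hom R A B"
    and eq: "\<And>x b. \<lbrakk>x \<in> L; b \<in> C x\<rbrakk> \<Longrightarrow> S b = T b" and a: "a \<in> carrier A"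
  shows "S a = T a"
proof -
  interpret B: module R B by fact
  have c: "coords a \<in> supp a \<rightarrow> carrier A" using a by (auto simp: supp_def)
  have A: "module R A" by (rule module_axioms)
  have "S (finsum A (coords a) (supp a)) = T (finsum A (coords a) (supp a))"
    using a c unfolding module_hom_finsum[OF A B S coords(2)[OF a] c]
      module_hom_finsum[OF A B T coords(2)[OF a] c]
    by (intro B.finsum_cong')
      (auto simp: supp_def eq coords_summand intro: module_hom_closed[OF T])
  then show ?thesis using coords(3)[OF a] by simp
qed

text \<open>
  Scaling each summand by its own scalar. This is the map that a Miyamoto map is for the scalars
  \<open>\<chi> (\<xi> x)\<close>; linearity comes down to that of the coordinates.
\<close>

lemma diagonal_map_exists:
  assumes c: "c \<in> L \<rightarrow> carrier R"
  obtains T where "T \<in> module_hom R A A" "\<And>x b. \<lbrakk>x \<in> L; b \<in> C x\<rbrakk> \<Longrightarrow> T b = c x \<odot>\<^bsub>A\<^esub> b"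
proof -
  have c': "x \<in> L \<Longrightarrow> c x \<in> carrier R" for x using c by auto
  define T where "T = (\<lambda>a\<in>carrier A. finsum A (\<lambda>x. c x \<odot>\<^bsub>A\<^esub> coords a x) (supp a))"
  have T: "T a = finsum A (\<lambda>x. c x \<odot>\<^bsub>A\<^esub> coords a x) F"
    if "a \<in> carrier A" "finite F" "supp a \<subseteq> F" "F \<subseteq> L" for a F
  proof -
    have "finsum A (\<lambda>x. c x \<odot>\<^bsub>A\<^esub> coords a x) (supp a) = finsum A (\<lambda>x. c x \<odot>\<^bsub>A\<^esub> coords a x) F"
      using that c' by (intro add.finprod_mono_neutral_cong_left) (auto simp: supp_def smult_r_null subset_iff)
    with that show ?thesis by (simp add: T_def)
  qed
  have closed: "T a \<in> carrier A" if "a \<in> carrier A" for a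
    using that c' by (auto simp: T_def supp_def)
  show thesis
  proof
    show "T \<in> module_hom R A A"
      unfolding module_hom_def
    proof (intro CollectI conjI ballI)
      show "T \<in> carrier A \<rightarrow>\<^sub>E carrier A" using closed by (auto simp: T_def)
    next
      fix a b assume a: "a \<in> carrier A" and b: "b \<in> carrier A"
      let ?F = "supp a \<union> supp b"
      have F: "finite ?F" "?F \<subseteq> L" using coords(2) a b by (auto simp: supp_def)
      have "supp (a \<oplus>\<^bsub>A\<^esub> b) \<subseteq> ?F"
        using a b by (auto simp: supp_def coords_add)
      then have "T (a \<oplus>\<^bsub>A\<^esub> b) = finsum A (\<lambda>x. c x \<odot>\<^bsub>A\<^esub> coords (a \<oplus>\<^bsub>A\<^esub> b) x) ?F"
        using a b F by (intro T) auto
      also have "\<dots> = finsum A (\<lambda>x. c x \<odot>\<^bsub>A\<^esub> coords a x \<oplus>\<^bsub>A\<^esub> c x \<odot>\<^bsub>A\<^esub> coords b x) ?F"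
        using a b F c' by (intro finsum_cong') (auto simp: coords_add smult_r_distr subset_iff)
      also have "\<dots> = T a \<oplus>\<^bsub>A\<^esub> T b"
        using a b F c' T[OF a F(1) _ F(2)] T[OF b F(1) _ F(2)] by (subst finsum_addf) auto
      finally show "T (a \<oplus>\<^bsub>A\<^esub> b) = T a \<oplus>\<^bsub>A\<^esub> T b" .
    next
      fix r a assume r: "r \<in> carrier R" and a: "a \<in> carrier A"
      have F: "finite (supp a)" "supp a \<subseteq> L" using coords(2) a by (auto simp: supp_def)
      have "supp (r \<odot>\<^bsub>A\<^esub> a) \<subseteq> supp a"
        using a r by (auto simp: supp_def coords_smult smult_r_null)
      then have "T (r \<odot>\<^bsub>A\<^esub> a) = finsum A (\<lambda>x. c x \<odot>\<^bsub>A\<^esub> coords (r \<odot>\<^bsub>A\<^esub> a) x) (supp a)"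
        using a r F by (intro T) auto
      also have "\<dots> = finsum A (\<lambda>x. r \<odot>\<^bsub>A\<^esub> (c x \<odot>\<^bsub>A\<^esub> coords a x)) (supp a)"
        using a r F c'
        by (intro finsum_cong') (auto simp: coords_smult subset_iff smult_assoc1[symmetric] R.m_comm)
      also have "\<dots> = r \<odot>\<^bsub>A\<^esub> finsum A (\<lambda>x. c x \<odot>\<^bsub>A\<^esub> coords a x) (supp a)"
        using a r F c' by (intro finsum_smult_ldistr[symmetric]) auto
      also have "\<dots> = r \<odot>\<^bsub>A\<^esub> T a" using a by (simp add: T_def)
      finally show "T (r \<odot>\<^bsub>A\<^esub> a) = r \<odot>\<^bsub>A\<^esub> T a" .
    qed
  next
    fix x b assume x: "x \<in> L" and b: "b \<in> C x"
    have "supp b \<subseteq> {x}" using x b by (auto simp: supp_def coords_of_summand)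
    then have "T b = finsum A (\<lambda>y. c y \<odot>\<^bsub>A\<^esub> coords b y) {x}"
      using x b summand_closed by (intro T) auto
    also have "\<dots> = c x \<odot>\<^bsub>A\<^esub> b"
      using x b summand_closed c' by (simp add: coords_of_summand)
    finally show "T b = c x \<odot>\<^bsub>A\<^esub> b" .
  qed
qed

end

section \<open>Categories of groups and of axial decomposition algebras\<close>

lemma is_category_Grp: "is_category Grp"
  unfolding is_category_def Grp_def
proof (intro conjI ballI; simp only: cat.simps mem_Collect_eq)
  fix A :: "'h monoid" assume "group A"
  then interpret group A .
  show "(\<lambda>x\<in>carrier A. x) \<in> hom A A \<inter> extensional (carrier A)" by (auto simp: hom_def)
next
  fix A B C :: "'h monoid" and f g
  assume "group A" and f: "f \<in> hom A B \<inter> extensional (carrier A)"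
    and g: "g \<in> hom B C \<inter> extensional (carrier B)"
  then interpret group A by simp
  show "compose (carrier A) g f \<in> hom A C \<inter> extensional (carrier A)"
    using f g by (auto simp: hom_compose)
next
  fix A B :: "'h monoid" and f assume "f \<in> hom A B \<inter> extensional (carrier A)"
  then show "compose (carrier A) f (\<lambda>x\<in>carrier A. x) = f"
    "compose (carrier A) (\<lambda>x\<in>carrier B. x) f = f"
    by (auto simp: hom_def)
next
  fix A B C D :: "'h monoid" and f g h assume "f \<in> hom A B \<inter> extensional (carrier A)"
  then show "compose (carrier A) h (compose (carrier A) g f) = compose (carrier A) (compose (carrier B) h g) f"
    by (intro compose_assoc) (auto simp: hom_def)
qed

lemma full_subcategory_simps [simp]:
  "Ob (full_subcategory C P) = {A \<in> Ob C. P A}"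
  "Hom (full_subcategory C P) = Hom C"
  "Id (full_subcategory C P) = Id C"
  "Comp (full_subcategory C P) = Comp C"
  by (simp_all add: full_subcategory_def)

lemma is_category_full_subcategory: "is_category C \<Longrightarrow> is_category (full_subcategory C P)"
  unfolding is_category_def by simp

lemma algebra_hom_PiE: "f \<in> algebra_hom R A B \<Longrightarrow> f \<in> carrier A \<rightarrow>\<^sub>E carrier B"
  by (simp add: algebra_hom_def module_hom_def)

lemma algebra_hom_id:
  assumes "nonassoc_algebra R A"
  shows "(\<lambda>a\<in>carrier A. a) \<in> algebra_hom R A A"
proof -
  interpret nonassoc_algebra R A by fact
  show ?thesis by (auto simp: algebra_hom_def module_hom_def prod_closed)
qed

lemma algebra_hom_compose:
  assumes "nonassoc_algebra R A" "f \<in> algebra_hom R A B" "g \<in> algebra_hom R B C"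
  shows "compose (carrier A) g f \<in> algebra_hom R A C"
proof -
  interpret nonassoc_algebra R A by fact
  have "compose (carrier A) g f \<in> module_hom R A C"
    using assms module_axioms by (auto simp: algebra_hom_def intro!: module_hom_compose)
  moreover have "f a \<in> carrier B" if "a \<in> carrier A" for a
    using algebra_hom_PiE[OF assms(2)] that by auto
  ultimately show ?thesis
    using assms(2,3) by (auto simp: algebra_hom_def compose_def prod_closed)
qed

lemma direct_sum_component:
  assumes "is_dec_algebra R \<Phi> D" "i \<in> idx D"
  shows "direct_sum R (alg D) (labels \<Phi>) (component D i)"
  using assms
  by (auto simp: is_dec_algebra_def is_decomposition_def nonassoc_algebra_def
      intro!: direct_sum.intro direct_sum_axioms.intro)

lemma component_closed:
  assumes "is_dec_algebra R \<Phi> D" "i \<in> idx D" "x \<in> labels \<Phi>" "b \<in> component D i x"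
  shows "b \<in> carrier (alg D)"
  using direct_sum.summand_closed[OF direct_sum_component[OF assms(1,2)]] assms(3,4) .

lemma axdec_homD:
  assumes "(\<phi>, \<psi>) \<in> axdec_hom R \<Phi> D E"
  shows "\<phi> \<in> algebra_hom R (alg D) (alg E)" "\<psi> \<in> idx D \<rightarrow>\<^sub>E idx E"
    "\<And>i x b. \<lbrakk>i \<in> idx D; x \<in> labels \<Phi>; b \<in> component D i x\<rbrakk> \<Longrightarrow> \<phi> b \<in> component E (\<psi> i) x"
    "\<And>i. i \<in> idx D \<Longrightarrow> \<phi> (axis D i) = axis E (\<psi> i)"
    "\<And>i. i \<in> idx D \<Longrightarrow> \<psi> i \<in> idx E"
  using assms by (auto simp: axdec_hom_def dec_algebra_hom_def image_subset_iff)

lemma axdec_homI: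
  assumes "\<phi> \<in> algebra_hom R (alg D) (alg E)" "\<psi> \<in> idx D \<rightarrow>\<^sub>E idx E"
    "\<And>i x b. \<lbrakk>i \<in> idx D; x \<in> labels \<Phi>; b \<in> component D i x\<rbrakk> \<Longrightarrow> \<phi> b \<in> component E (\<psi> i) x"
    "\<And>i. i \<in> idx D \<Longrightarrow> \<phi> (axis D i) = axis E (\<psi> i)"
  shows "(\<phi>, \<psi>) \<in> axdec_hom R \<Phi> D E"
  using assms by (auto simp: axdec_hom_def dec_algebra_hom_def image_subset_iff)

lemma axis_closed:
  assumes "is_axdec_algebra R \<Phi> e lam D" "e \<in> labels \<Phi>" "i \<in> idx D"
  shows "axis D i \<in> carrier (alg D)"
  using assms component_closed[of R \<Phi> D i e] by (auto simp: is_axdec_algebra_def)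

lemma is_category_AxDec:
  fixes R :: "('r, 'y) ring_scheme" and \<Phi> :: "'x fusion"
  assumes e: "e \<in> labels \<Phi>"
  shows "is_category (AxDec R \<Phi> e lam :: (('r, 'a, 'i, 'x) axdec_algebra, _) cat)"
  unfolding is_category_def AxDec_def
proof (intro conjI ballI; simp only: cat.simps mem_Collect_eq)
  fix D :: "('r, 'a, 'i, 'x) axdec_algebra" assume D: "is_axdec_algebra R \<Phi> e lam D"
  then have dec: "is_dec_algebra R \<Phi> D" by (simp add: is_axdec_algebra_def)
  then have "nonassoc_algebra R (alg D)" by (simp add: is_dec_algebra_def)
  then show "(\<lambda>a\<in>carrier (alg D). a, \<lambda>i\<in>idx D. i) \<in> axdec_hom R \<Phi> D D"
    using component_closed[OF dec] axis_closed[OF D e]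
    by (intro axdec_homI) (auto simp: algebra_hom_id)
next
  fix D E F :: "('r, 'a, 'i, 'x) axdec_algebra" and f g
  assume D: "is_axdec_algebra R \<Phi> e lam D"
    and f: "f \<in> axdec_hom R \<Phi> D E" and g: "g \<in> axdec_hom R \<Phi> E F"
  obtain f1 f2 g1 g2 where fg: "f = (f1, f2)" "g = (g1, g2)" by fastforce
  from D have dec: "is_dec_algebra R \<Phi> D" by (simp add: is_axdec_algebra_def)
  then have alg: "nonassoc_algebra R (alg D)" by (simp add: is_dec_algebra_def)
  note f' = axdec_homD[OF f[unfolded fg]] and g' = axdec_homD[OF g[unfolded fg]]
  have "(compose (carrier (alg D)) g1 f1, compose (idx D) g2 f2) \<in> axdec_hom R \<Phi> D F"
  proof (rule axdec_homI)
    show "compose (carrier (alg D)) g1 f1 \<in> algebra_hom R (alg D) (alg F)"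
      using algebra_hom_compose[OF alg f'(1) g'(1)] .
    show "compose (idx D) g2 f2 \<in> idx D \<rightarrow>\<^sub>E idx F"
      using f'(5) g'(5) by (auto simp: compose_def)
  qed (use f' g' component_closed[OF dec] axis_closed[OF D e] in \<open>auto simp: compose_eq\<close>)
  then show "(compose (carrier (alg D)) (fst g) (fst f), compose (idx D) (snd g) (snd f))
      \<in> axdec_hom R \<Phi> D F"
    by (simp add: fg)
next
  fix D E :: "('r, 'a, 'i, 'x) axdec_algebra" and f
  assume f: "f \<in> axdec_hom R \<Phi> D E"
  obtain f1 f2 where fg: "f = (f1, f2)" by fastforce
  note f' = algebra_hom_PiE[OF axdec_homD(1)[OF f[unfolded fg]]] axdec_homD(2)[OF f[unfolded fg]]
  show "(compose (carrier (alg D)) (fst f) (fst (\<lambda>a\<in>carrier (alg D). a, \<lambda>i\<in>idx D. i)),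
       compose (idx D) (snd f) (snd (\<lambda>a\<in>carrier (alg D). a, \<lambda>i\<in>idx D. i))) = f"
    "(compose (carrier (alg D)) (fst (\<lambda>a\<in>carrier (alg E). a, \<lambda>i\<in>idx E. i)) (fst f),
       compose (idx D) (snd (\<lambda>a\<in>carrier (alg E). a, \<lambda>i\<in>idx E. i)) (snd f)) = f"
    using f' by (auto simp: fg PiE_def intro: compose_Id Id_compose)
next
  fix D E F G :: "('r, 'a, 'i, 'x) axdec_algebra" and f g h
  assume f: "f \<in> axdec_hom R \<Phi> D E"
  obtain f1 f2 where fg: "f = (f1, f2)" by fastforce
  note f' = algebra_hom_PiE[OF axdec_homD(1)[OF f[unfolded fg]]] axdec_homD(2)[OF f[unfolded fg]]
  then have "f1 \<in> carrier (alg D) \<rightarrow> carrier (alg E)" "f2 \<in> idx D \<rightarrow> idx E"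
    by auto
  then show "(compose (carrier (alg D)) (fst h)
        (fst (compose (carrier (alg D)) (fst g) (fst f), compose (idx D) (snd g) (snd f))),
       compose (idx D) (snd h)
        (snd (compose (carrier (alg D)) (fst g) (fst f), compose (idx D) (snd g) (snd f))))
    = (compose (carrier (alg D))
        (fst (compose (carrier (alg E)) (fst h) (fst g), compose (idx E) (snd h) (snd g))) (fst f),
       compose (idx D)
        (snd (compose (carrier (alg E)) (fst h) (fst g), compose (idx E) (snd h) (snd g))) (snd f))"
    by (simp add: fg compose_assoc)
qed

section \<open>Groups of characters and of algebra automorphisms\<close>

lemma group_character_group:
  assumes "cring R" "group \<Gamma>"
  shows "group (character_group R \<Gamma>)"
proof -
  interpret R: cring R by fact
  interpret \<Gamma>: group \<Gamma> by fact
  interpret U: comm_group "units_of R" by (rule R.units_comm_group)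
  have U: "carrier (units_of R) = Units R" "monoid.mult (units_of R) = monoid.mult R"
    "one (units_of R) = one R"
    by (simp_all add: units_of_def)
  have Uclosed: "\<chi> g \<in> carrier R" if "\<chi> \<in> hom \<Gamma> (units_of R)" "g \<in> carrier \<Gamma>" for \<chi> g
    using that U by (auto simp: hom_def)
  show ?thesis
  proof (rule groupI)
    fix \<chi> \<psi> assume "\<chi> \<in> carrier (character_group R \<Gamma>)" "\<psi> \<in> carrier (character_group R \<Gamma>)"
    then show "\<chi> \<otimes>\<^bsub>character_group R \<Gamma>\<^esub> \<psi> \<in> carrier (character_group R \<Gamma>)"
      using U.m_ac U.m_closed unfolding character_group_def hom_def U by (auto simp: Pi_iff)
  next
    show "\<one>\<^bsub>character_group R \<Gamma>\<^esub> \<in> carrier (character_group R \<Gamma>)"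
      by (auto simp: character_group_def hom_def U)
  next
    fix \<chi> \<psi> \<omega> assume "\<chi> \<in> carrier (character_group R \<Gamma>)" "\<psi> \<in> carrier (character_group R \<Gamma>)"
      "\<omega> \<in> carrier (character_group R \<Gamma>)"
    then show "\<chi> \<otimes>\<^bsub>character_group R \<Gamma>\<^esub> \<psi> \<otimes>\<^bsub>character_group R \<Gamma>\<^esub> \<omega>
      = \<chi> \<otimes>\<^bsub>character_group R \<Gamma>\<^esub> (\<psi> \<otimes>\<^bsub>character_group R \<Gamma>\<^esub> \<omega>)"
      by (auto simp: character_group_def Uclosed R.m_assoc)
  next
    fix \<chi> assume "\<chi> \<in> carrier (character_group R \<Gamma>)"
    then have \<chi>: "\<chi> \<in> hom \<Gamma> (units_of R)" "\<chi> \<in> extensional (carrier \<Gamma>)"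
      by (auto simp: character_group_def)
    show "\<one>\<^bsub>character_group R \<Gamma>\<^esub> \<otimes>\<^bsub>character_group R \<Gamma>\<^esub> \<chi> = \<chi>"
      using \<chi> by (auto simp: character_group_def Uclosed intro!: extensionalityI[OF _ \<chi>(2)])
    let ?\<psi> = "\<lambda>g\<in>carrier \<Gamma>. inv\<^bsub>units_of R\<^esub> (\<chi> g)"
    have "?\<psi> \<in> hom \<Gamma> (units_of R)"
    proof (rule homI)
      fix g assume "g \<in> carrier \<Gamma>"
      then show "?\<psi> g \<in> carrier (units_of R)" using \<chi>(1) by (auto simp: hom_def)
    next
      fix g h assume gh: "g \<in> carrier \<Gamma>" "h \<in> carrier \<Gamma>"
      then have "\<chi> g \<in> carrier (units_of R)" "\<chi> h \<in> carrier (units_of R)"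
        using \<chi>(1) by (auto simp: hom_def)
      then show "?\<psi> (g \<otimes>\<^bsub>\<Gamma>\<^esub> h) = ?\<psi> g \<otimes>\<^bsub>units_of R\<^esub> ?\<psi> h"
        using gh hom_mult[OF \<chi>(1) gh] by (simp add: U.inv_mult)
    qed
    moreover have "?\<psi> g \<otimes>\<^bsub>R\<^esub> \<chi> g = \<one>\<^bsub>R\<^esub>" if "g \<in> carrier \<Gamma>" for g
      using that \<chi>(1) U.l_inv[of "\<chi> g"] by (auto simp: hom_def U)
    ultimately show "\<exists>\<psi>\<in>carrier (character_group R \<Gamma>).
        \<psi> \<otimes>\<^bsub>character_group R \<Gamma>\<^esub> \<chi> = \<one>\<^bsub>character_group R \<Gamma>\<^esub>"
      by (intro bexI[of _ ?\<psi>]) (auto simp: character_group_def)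
  qed
qed

lemma group_algebra_Aut:
  assumes "nonassoc_algebra R A"
  shows "group (algebra_Aut R A)"
proof -
  interpret nonassoc_algebra R A by fact
  interpret Bij: group "BijGroup (carrier A)" by (rule group_BijGroup)
  have "subgroup (algebra_hom R A A \<inter> Bij (carrier A)) (BijGroup (carrier A))"
  proof (rule Bij.subgroupI)
    show "algebra_hom R A A \<inter> Bij (carrier A) \<subseteq> carrier (BijGroup (carrier A))"
      by (auto simp: BijGroup_def)
    show "algebra_hom R A A \<inter> Bij (carrier A) \<noteq> {}"
      using algebra_hom_id[OF assms] id_Bij by blast
  next
    fix f g assume "f \<in> algebra_hom R A A \<inter> Bij (carrier A)" "g \<in> algebra_hom R A A \<inter> Bij (carrier A)"
    then show "f \<otimes>\<^bsub>BijGroup (carrier A)\<^esub> g \<in> algebra_hom R A A \<inter> Bij (carrier A)"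
      using algebra_hom_compose[OF assms] by (auto simp: BijGroup_def compose_Bij)
  next
    fix f assume f: "f \<in> algebra_hom R A A \<inter> Bij (carrier A)"
    define g where "g = (\<lambda>a\<in>carrier A. inv_into (carrier A) f a)"
    have inv: "inv\<^bsub>BijGroup (carrier A)\<^esub> f = g" using f by (simp add: g_def inv_BijGroup)
    have closed: "g a \<in> carrier A" if "a \<in> carrier A" for a
      using f that Bij_inv_into_mem by (auto simp: g_def)
    have fg: "f (g a) = a" if "a \<in> carrier A" for a
      using f that by (auto simp: g_def Bij_def bij_betw_def f_inv_into_f)
    have inj: "inj_on f (carrier A)" using f by (auto simp: Bij_def bij_betw_def)
    have f_hom: "f (a \<oplus>\<^bsub>A\<^esub> b) = f a \<oplus>\<^bsub>A\<^esub> f b" "f (a \<otimes>\<^bsub>A\<^esub> b) = f a \<otimes>\<^bsub>A\<^esub> f b"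
      if "a \<in> carrier A" "b \<in> carrier A" for a b
      using f that by (auto simp: algebra_hom_def module_hom_def)
    have f_smult: "f (r \<odot>\<^bsub>A\<^esub> a) = r \<odot>\<^bsub>A\<^esub> f a" if "a \<in> carrier A" "r \<in> carrier R" for a r
      using f that by (auto simp: algebra_hom_def module_hom_def)
    have "g \<in> algebra_hom R A A"
      unfolding algebra_hom_def module_hom_def
    proof (intro CollectI conjI ballI)
      show "g \<in> carrier A \<rightarrow>\<^sub>E carrier A" using closed by (auto simp: g_def)
    next
      fix a b assume "a \<in> carrier A" "b \<in> carrier A"
      then show "g (a \<oplus>\<^bsub>A\<^esub> b) = g a \<oplus>\<^bsub>A\<^esub> g b"
        by - (rule inj_onD[OF inj], simp_all add: f_hom fg closed)
    next
      fix r a assume "r \<in> carrier R" "a \<in> carrier A"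
      then show "g (r \<odot>\<^bsub>A\<^esub> a) = r \<odot>\<^bsub>A\<^esub> g a"
        by - (rule inj_onD[OF inj], simp_all add: f_smult fg closed)
    next
      fix a b assume "a \<in> carrier A" "b \<in> carrier A"
      then show "g (a \<otimes>\<^bsub>A\<^esub> b) = g a \<otimes>\<^bsub>A\<^esub> g b"
        by - (rule inj_onD[OF inj], simp_all add: f_hom fg closed prod_closed)
    qed
    moreover have "g \<in> Bij (carrier A)"
      unfolding g_def using f by (intro restrict_inv_into_Bij) simp
    ultimately show "inv\<^bsub>BijGroup (carrier A)\<^esub> f \<in> algebra_hom R A A \<inter> Bij (carrier A)"
      by (simp add: inv)
  qed
  then show ?thesis
    unfolding algebra_Aut_def by (rule subgroup.subgroup_is_group) (rule Bij.is_group)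
qed

text \<open>
  Writing the conjugation relation without the inverse turns it into an intertwining relation,
  the form in which naturality delivers it.
\<close>

lemma algebra_Aut_conj_iff:
  assumes "nonassoc_algebra R A" and "\<theta> \<in> algebra_hom R A A \<inter> Bij (carrier A)"
    "\<sigma> \<in> algebra_hom R A A \<inter> Bij (carrier A)" "\<tau> \<in> algebra_hom R A A \<inter> Bij (carrier A)"
  shows "\<theta> \<otimes>\<^bsub>algebra_Aut R A\<^esub> \<sigma> \<otimes>\<^bsub>algebra_Aut R A\<^esub> inv\<^bsub>algebra_Aut R A\<^esub> \<theta> = \<tau>
    \<longleftrightarrow> compose (carrier A) \<theta> \<sigma> = compose (carrier A) \<tau> \<theta>"
proof -
  interpret Aut: group "algebra_Aut R A" by (rule group_algebra_Aut) fact
  have mem: "\<theta> \<in> carrier (algebra_Aut R A)" "\<sigma> \<in> carrier (algebra_Aut R A)"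
    "\<tau> \<in> carrier (algebra_Aut R A)"
    using assms(2-4) by (auto simp: algebra_Aut_def)
  have "\<theta> \<otimes>\<^bsub>algebra_Aut R A\<^esub> \<sigma> \<otimes>\<^bsub>algebra_Aut R A\<^esub> inv\<^bsub>algebra_Aut R A\<^esub> \<theta> = \<tau>
    \<longleftrightarrow> \<theta> \<otimes>\<^bsub>algebra_Aut R A\<^esub> \<sigma> = \<tau> \<otimes>\<^bsub>algebra_Aut R A\<^esub> \<theta>"
    using mem by (metis Aut.inv_solve_right Aut.m_closed)
  moreover have "f \<otimes>\<^bsub>algebra_Aut R A\<^esub> g = compose (carrier A) f g"
    if "f \<in> Bij (carrier A)" "g \<in> Bij (carrier A)" for f g
    using that by (simp add: algebra_Aut_def BijGroup_def)
  ultimately show ?thesis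
    using assms(2-4) by simp
qed

section \<open>Miyamoto maps\<close>

locale graded_characters =
  fixes R :: "('r, 'y) ring_scheme" and \<Gamma> :: "('g, 'w) monoid_scheme" and Y :: "('g \<Rightarrow> 'r) set"
    and \<Phi> :: "'x fusion" and \<xi> :: "'x \<Rightarrow> 'g"
  assumes cring_R: "cring R" and group_\<Gamma>: "group \<Gamma>"
    and subgroup_Y: "subgroup Y (character_group R \<Gamma>)"
    and grading: "is_grading \<Phi> \<Gamma> \<xi>"
begin

abbreviation \<tau> :: "('r, 'a, 'i, 'x, 'z) dec_algebra_scheme \<Rightarrow> 'i \<Rightarrow> ('g \<Rightarrow> 'r) \<Rightarrow> 'a \<Rightarrow> 'a" where
  "\<tau> \<equiv> miyamoto_map R \<Phi> \<Gamma> \<xi>"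

lemma grading_closed: "x \<in> labels \<Phi> \<Longrightarrow> \<xi> x \<in> carrier \<Gamma>"
  using grading by (auto simp: is_grading_def)

lemma character_closed: "\<chi> \<in> Y \<Longrightarrow> g \<in> carrier \<Gamma> \<Longrightarrow> \<chi> g \<in> carrier R"
  using subgroup.subset[OF subgroup_Y]
  by (auto simp: character_group_def hom_def units_of_def Units_def)

text \<open>
  Miyamoto maps are specified on the components of the \<open>\<Gamma>\<close>-grading, but morphisms are specified on
  the finer components indexed by labels. A graded component is the sum of the fine components of its
  degree, so for linear maps the two ways of prescribing the eigenvalues agree.
\<close>

lemma eigen_graded_comp_iff:
  assumes D: "is_dec_algebra R \<Phi> D" and i: "i \<in> idx D" and \<chi>: "\<chi> \<in> Y"
    and T: "T \<in> module_hom R (alg D) (alg D)"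
  shows "(\<forall>g\<in>carrier \<Gamma>. \<forall>a\<in>graded_comp \<Phi> \<xi> D i g. T a = \<chi> g \<odot>\<^bsub>alg D\<^esub> a) \<longleftrightarrow>
    (\<forall>x\<in>labels \<Phi>. \<forall>b\<in>component D i x. T b = \<chi> (\<xi> x) \<odot>\<^bsub>alg D\<^esub> b)" (is "?graded \<longleftrightarrow> ?fine")
proof
  interpret direct_sum R "alg D" "labels \<Phi>" "component D i"
    using direct_sum_component[OF D i] .
  assume graded: ?graded
  show ?fine
  proof (intro ballI)
    fix x b assume x: "x \<in> labels \<Phi>" and b: "b \<in> component D i x"
    have "b = finsum (alg D) (\<lambda>_. b) {x}"
      using summand_closed[OF x b] by simp
    with x b have "b \<in> graded_comp \<Phi> \<xi> D i (\<xi> x)"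
      unfolding graded_comp_def submodule_sum_def
      by (intro CollectI exI[of _ "\<lambda>_. b"] exI[of _ "{x}"]) auto
    with graded x show "T b = \<chi> (\<xi> x) \<odot>\<^bsub>alg D\<^esub> b"
      using grading_closed by blast
  qed
next
  interpret direct_sum R "alg D" "labels \<Phi>" "component D i"
    using direct_sum_component[OF D i] .
  assume fine: ?fine
  show ?graded
  proof (intro ballI)
    fix g a assume g: "g \<in> carrier \<Gamma>" and "a \<in> graded_comp \<Phi> \<xi> D i g"
    then obtain f F where a: "a = finsum (alg D) f F" and F: "finite F"
      "F \<subseteq> {x \<in> labels \<Phi>. \<xi> x = g}" and f: "f \<in> (\<Pi> x\<in>F. component D i x)"
      by (auto simp: graded_comp_def submodule_sum_def)
    have fx: "x \<in> labels \<Phi>" "\<xi> x = g" "f x \<in> component D i x" if "x \<in> F" for x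
      using that F(2) f by auto
    have fc: "f \<in> F \<rightarrow> carrier (alg D)" using fx summand_closed by blast
    have Tf: "T (f x) = \<chi> g \<odot>\<^bsub>alg D\<^esub> f x" if "x \<in> F" for x
      using fine fx[OF that] by auto
    have "T a = finsum (alg D) (\<lambda>x. T (f x)) F"
      unfolding a by (rule module_hom_finsum[OF module_axioms module_axioms T F(1) fc])
    also have "\<dots> = finsum (alg D) (\<lambda>x. \<chi> g \<odot>\<^bsub>alg D\<^esub> f x) F"
      using Tf fc character_closed[OF \<chi> g] by (intro finsum_cong') (auto simp: Pi_iff)
    also have "\<dots> = \<chi> g \<odot>\<^bsub>alg D\<^esub> a"
      unfolding a by (rule finsum_smult_ldistr[OF F(1) character_closed[OF \<chi> g] fc, symmetric])
    finally show "T a = \<chi> g \<odot>\<^bsub>alg D\<^esub> a" .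
  qed
qed

text \<open>
  The description that defines \<open>miyamoto_map\<close> is satisfied by exactly one map, because a linear
  map scaling the summands of a direct sum exists and is unique.
\<close>

lemma miyamoto_map:
  assumes D: "is_dec_algebra R \<Phi> D" and i: "i \<in> idx D" and \<chi>: "\<chi> \<in> Y"
  shows "\<tau> D i \<chi> \<in> module_hom R (alg D) (alg D)"
    and "\<And>x b. \<lbrakk>x \<in> labels \<Phi>; b \<in> component D i x\<rbrakk> \<Longrightarrow> \<tau> D i \<chi> b = \<chi> (\<xi> x) \<odot>\<^bsub>alg D\<^esub> b"
proof -
  interpret direct_sum R "alg D" "labels \<Phi>" "component D i"
    using direct_sum_component[OF D i] .
  let ?spec = "\<lambda>T. T \<in> module_hom R (alg D) (alg D) \<and>
     (\<forall>g\<in>carrier \<Gamma>. \<forall>a\<in>graded_comp \<Phi> \<xi> D i g. T a = \<chi> g \<odot>\<^bsub>alg D\<^esub> a)"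
  let ?eigen = "\<lambda>T. \<forall>x\<in>labels \<Phi>. \<forall>b\<in>component D i x. T b = \<chi> (\<xi> x) \<odot>\<^bsub>alg D\<^esub> b"
  have spec_iff: "?spec T \<longleftrightarrow> T \<in> module_hom R (alg D) (alg D) \<and> ?eigen T" for T
    using eigen_graded_comp_iff[OF D i \<chi>] by blast
  have "(\<lambda>x. \<chi> (\<xi> x)) \<in> labels \<Phi> \<rightarrow> carrier R"
    using character_closed[OF \<chi>] grading_closed by auto
  then obtain T where T: "T \<in> module_hom R (alg D) (alg D)" "?eigen T"
    using diagonal_map_exists by metis
  have "S = T" if S: "S \<in> module_hom R (alg D) (alg D)" "?eigen S" for S
  proof (rule extensionalityI)
    show "S \<in> extensional (carrier (alg D))" "T \<in> extensional (carrier (alg D))"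
      using S(1) T(1) by (auto simp: module_hom_def PiE_iff)
    fix a assume "a \<in> carrier (alg D)"
    then show "S a = T a"
      using module_hom_eqI[OF module_axioms S(1) T(1)] S(2) T(2) by simp
  qed
  with T have "\<exists>!T. ?spec T" unfolding spec_iff by blast
  then have "?spec (\<tau> D i \<chi>)"
    unfolding miyamoto_map_def by (rule theI')
  then show "\<tau> D i \<chi> \<in> module_hom R (alg D) (alg D)"
    and "\<And>x b. \<lbrakk>x \<in> labels \<Phi>; b \<in> component D i x\<rbrakk> \<Longrightarrow> \<tau> D i \<chi> b = \<chi> (\<xi> x) \<odot>\<^bsub>alg D\<^esub> b"
    unfolding spec_iff by blast+
qed

text \<open>
  Both sides are linear, and on an element \<open>b\<close> of the component with label \<open>x\<close> both give \<open>\<chi> (\<xi> x) \<phi> b\<close>, as \<open>\<phi>\<close>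
  carries \<open>b\<close> into the component of the same label. It is used for morphisms between different
  algebras and also for a Miyamoto map in the role of \<open>\<phi>\<close>.
\<close>

lemma miyamoto_map_natural:
  assumes D: "is_dec_algebra R \<Phi> D" and E: "is_dec_algebra R \<Phi> E"
    and f: "(\<phi>, \<psi>) \<in> dec_algebra_hom R \<Phi> D E" and i: "i \<in> idx D" and \<chi>: "\<chi> \<in> Y"
  shows "compose (carrier (alg D)) \<phi> (\<tau> D i \<chi>) = compose (carrier (alg D)) (\<tau> E (\<psi> i) \<chi>) \<phi>"
    (is "?l = ?r")
proof (rule extensionalityI)
  interpret direct_sum R "alg D" "labels \<Phi>" "component D i"
    using direct_sum_component[OF D i] .
  have \<phi>: "\<phi> \<in> module_hom R (alg D) (alg E)" and \<psi>: "\<psi> i \<in> idx E"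
    and comp: "\<And>x b. x \<in> labels \<Phi> \<Longrightarrow> b \<in> component D i x \<Longrightarrow> \<phi> b \<in> component E (\<psi> i) x"
    using f i by (auto simp: dec_algebra_hom_def algebra_hom_def image_subset_iff)
  note \<tau>D = miyamoto_map[OF D i \<chi>] and \<tau>E = miyamoto_map[OF E \<psi> \<chi>]
  have ME: "module R (alg E)" using E by (simp add: is_dec_algebra_def nonassoc_algebra_def)
  show "?l a = ?r a" if "a \<in> carrier (alg D)" for a
    using that
  proof (rule module_hom_eqI[OF ME, rotated 3])
    show "?l \<in> module_hom R (alg D) (alg E)" "?r \<in> module_hom R (alg D) (alg E)"
      using module_hom_compose \<phi> \<tau>D(1) \<tau>E(1) module_axioms by blast+
  next
    fix x b assume x: "x \<in> labels \<Phi>" and b: "b \<in> component D i x"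
    have bc: "b \<in> carrier (alg D)" using summand_closed[OF x b] .
    have "\<phi> (\<chi> (\<xi> x) \<odot>\<^bsub>alg D\<^esub> b) = \<chi> (\<xi> x) \<odot>\<^bsub>alg E\<^esub> \<phi> b"
      using \<phi> bc character_closed[OF \<chi> grading_closed[OF x]] by (auto simp: module_hom_def)
    then show "?l b = ?r b"
      using bc x b comp by (simp add: compose_eq \<tau>D(2) \<tau>E(2))
  qed
qed (auto simp: compose_def)

section \<open>Conjugation relations and axes\<close>

definition stable_unique :: "'x \<Rightarrow> ('x \<Rightarrow> 'r) \<Rightarrow> ('r, 'a, 'i, 'x) axdec_algebra \<Rightarrow> bool" where
  "stable_unique e lam D \<longleftrightarrow> is_axdec_algebra R \<Phi> e lam D \<and>
     miyamoto_stable R \<Phi> e lam \<Gamma> \<xi> Y D \<and> unique_type R \<Phi> \<Gamma> \<xi> Y D"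

lemma stable_unique_dec: "stable_unique e lam D \<Longrightarrow> is_dec_algebra R \<Phi> D"
  by (simp add: stable_unique_def is_axdec_algebra_def)

text \<open>
  Conjugation in the automorphism group makes sense only for a Miyamoto map that is bijective and
  multiplicative; both are inherited from the automorphism that stability provides.
\<close>

lemma stable_automorphism:
  assumes D: "stable_unique e lam D" and i: "i \<in> idx D" and \<chi>: "\<chi> \<in> Y"
  obtains \<pi> where "(\<tau> D i \<chi>, \<pi>) \<in> axdec_hom R \<Phi> D D"
    and "\<tau> D i \<chi> \<in> algebra_hom R (alg D) (alg D) \<inter> Bij (carrier (alg D))"
proof -
  obtain \<pi> where "is_automorphism (AxDec R \<Phi> e lam) D (\<tau> D i \<chi>, \<pi>)"
    using D i \<chi> by (auto simp: stable_unique_def miyamoto_stable_def)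
  then obtain \<theta> \<rho> where hom: "(\<tau> D i \<chi>, \<pi>) \<in> axdec_hom R \<Phi> D D"
    and inv: "(\<theta>, \<rho>) \<in> axdec_hom R \<Phi> D D"
    and comp: "compose (carrier (alg D)) \<theta> (\<tau> D i \<chi>) = (\<lambda>a\<in>carrier (alg D). a)"
      "compose (carrier (alg D)) (\<tau> D i \<chi>) \<theta> = (\<lambda>a\<in>carrier (alg D). a)"
    by (auto simp: is_automorphism_def AxDec_def)
  have ext: "\<tau> D i \<chi> \<in> carrier (alg D) \<rightarrow>\<^sub>E carrier (alg D)" "\<theta> \<in> carrier (alg D) \<rightarrow>\<^sub>E carrier (alg D)"
    by (rule algebra_hom_PiE[OF axdec_homD(1)[OF hom]], rule algebra_hom_PiE[OF axdec_homD(1)[OF inv]])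
  have "\<theta> (\<tau> D i \<chi> a) = a" "\<tau> D i \<chi> (\<theta> a) = a" if "a \<in> carrier (alg D)" for a
    using fun_cong[OF comp(1), of a] fun_cong[OF comp(2), of a] that by (simp_all add: compose_eq)
  then have "bij_betw (\<tau> D i \<chi>) (carrier (alg D)) (carrier (alg D))"
    using ext by (intro bij_betw_byWitness[of _ \<theta>]) auto
  then have "\<tau> D i \<chi> \<in> Bij (carrier (alg D))"
    using ext by (auto simp: Bij_def PiE_iff)
  with hom axdec_homD(1)[OF hom] that show thesis by blast
qed

text \<open>
  The definition of a conjugation pair quantifies over identities between
  automorphisms, which a morphism need not transport; the right-hand side is a single equation
  between elements, which it does. The equivalence holds because conjugation by \<open>\<tau>\<^sub>i\<^sub>,\<^sub>\<chi>\<close> takes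
  \<open>\<tau>\<^sub>j\<^sub>,\<^sub>\<chi>\<^sub>'\<close> to \<open>\<tau>\<^sub>\<pi>\<^sub>j\<^sub>,\<^sub>\<chi>\<^sub>'\<close>, while an index is determined by its Miyamoto maps and also by its axis.
\<close>

lemma conj_pairs_iff_axis:
  assumes D: "stable_unique e lam D" and i: "i \<in> idx D" and \<chi>: "\<chi> \<in> Y"
  shows "(j, k) \<in> conj_pairs R \<Phi> \<Gamma> \<xi> Y D (\<tau> D i \<chi>) \<longleftrightarrow>
    j \<in> idx D \<and> k \<in> idx D \<and> \<tau> D i \<chi> (axis D j) = axis D k"
proof (cases "j \<in> idx D \<and> k \<in> idx D")
  case True
  then have j: "j \<in> idx D" and k: "k \<in> idx D" by auto
  note dec = stable_unique_dec[OF D]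
  have alg: "nonassoc_algebra R (alg D)" using dec by (simp add: is_dec_algebra_def)
  have aut: "\<tau> D l \<chi>' \<in> algebra_hom R (alg D) (alg D) \<inter> Bij (carrier (alg D))"
    if "l \<in> idx D" "\<chi>' \<in> Y" for l \<chi>'
    using stable_automorphism[OF D that] by blast
  obtain \<pi> where \<pi>: "(\<tau> D i \<chi>, \<pi>) \<in> axdec_hom R \<Phi> D D"
    using stable_automorphism[OF D i \<chi>] by blast
  have \<pi>j: "\<pi> j \<in> idx D" and ax: "\<tau> D i \<chi> (axis D j) = axis D (\<pi> j)"
    using j axdec_homD(4,5)[OF \<pi>] by simp_all
  \<comment> \<open>Naturality of Miyamoto maps for the automorphism \<open>(\<tau>\<^sub>i\<^sub>,\<^sub>\<chi>, \<pi>)\<close>.\<close>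
  have conj: "compose (carrier (alg D)) (\<tau> D i \<chi>) (\<tau> D j \<chi>')
      = compose (carrier (alg D)) (\<tau> D (\<pi> j) \<chi>') (\<tau> D i \<chi>)" if "\<chi>' \<in> Y" for \<chi>'
    using \<pi> j that by (intro miyamoto_map_natural[OF dec dec]) (auto simp: axdec_hom_def)
  have cancel: "compose (carrier (alg D)) (\<tau> D (\<pi> j) \<chi>') (\<tau> D i \<chi>)
      = compose (carrier (alg D)) (\<tau> D k \<chi>') (\<tau> D i \<chi>) \<longleftrightarrow> \<tau> D (\<pi> j) \<chi>' = \<tau> D k \<chi>'"
    if \<chi>': "\<chi>' \<in> Y" for \<chi>'
  proof
    assume eq: "compose (carrier (alg D)) (\<tau> D (\<pi> j) \<chi>') (\<tau> D i \<chi>)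
      = compose (carrier (alg D)) (\<tau> D k \<chi>') (\<tau> D i \<chi>)"
    show "\<tau> D (\<pi> j) \<chi>' = \<tau> D k \<chi>'"
    proof (rule extensionalityI)
      show "\<tau> D (\<pi> j) \<chi>' \<in> extensional (carrier (alg D))" "\<tau> D k \<chi>' \<in> extensional (carrier (alg D))"
        using aut[OF \<pi>j \<chi>'] aut[OF k \<chi>'] by (auto simp: Bij_def)
      fix a assume "a \<in> carrier (alg D)"
      then obtain b where b: "b \<in> carrier (alg D)" "a = \<tau> D i \<chi> b"
        using aut[OF i \<chi>] by (auto simp: Bij_def bij_betw_def)
      then show "\<tau> D (\<pi> j) \<chi>' a = \<tau> D k \<chi>' a"
        using fun_cong[OF eq, of b] by (simp add: compose_eq)
    qed
  qed simp
  have "(j, k) \<in> conj_pairs R \<Phi> \<Gamma> \<xi> Y D (\<tau> D i \<chi>) \<longleftrightarrow>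
    (\<forall>\<chi>'\<in>Y. compose (carrier (alg D)) (\<tau> D i \<chi>) (\<tau> D j \<chi>')
      = compose (carrier (alg D)) (\<tau> D k \<chi>') (\<tau> D i \<chi>))"
    using j k by (simp add: conj_pairs_def algebra_Aut_conj_iff[OF alg aut[OF i \<chi>] aut[OF j] aut[OF k]])
  also have "\<dots> \<longleftrightarrow> (\<forall>\<chi>'\<in>Y. \<tau> D (\<pi> j) \<chi>' = \<tau> D k \<chi>')"
    by (simp add: conj cancel)
  \<comment> \<open>Distinct indices have different families of Miyamoto maps.\<close>
  also have "\<dots> \<longleftrightarrow> \<pi> j = k"
    using D \<pi>j k by (auto simp: stable_unique_def unique_type_def)
  \<comment> \<open>Distinct indices have distinct axes.\<close>
  also have "\<dots> \<longleftrightarrow> \<tau> D i \<chi> (axis D j) = axis D k"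
    using D \<pi>j k ax by (auto simp: stable_unique_def unique_type_def dest: inj_onD)
  finally show ?thesis using j k by simp
qed (auto simp: conj_pairs_def)

text \<open>
  Applying \<open>\<phi>\<close> to \<open>\<tau>\<^sub>i\<^sub>,\<^sub>\<chi> a\<^sub>j = a\<^sub>k\<close> and moving it past the Miyamoto map gives the corresponding
  equation between the axes \<open>\<psi> j\<close> and \<open>\<psi> k\<close>.
\<close>

lemma conj_pairs_mono:
  assumes e: "e \<in> labels \<Phi>" and D: "stable_unique e lam D" and E: "stable_unique e lam E"
    and f: "(\<phi>, \<psi>) \<in> axdec_hom R \<Phi> D E" and i: "i \<in> idx D" and \<chi>: "\<chi> \<in> Y"
    and jk: "(j, k) \<in> conj_pairs R \<Phi> \<Gamma> \<xi> Y D (\<tau> D i \<chi>)"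
  shows "(\<psi> j, \<psi> k) \<in> conj_pairs R \<Phi> \<Gamma> \<xi> Y E (\<tau> E (\<psi> i) \<chi>)"
proof -
  note f' = axdec_homD[OF f]
  have j: "j \<in> idx D" and k: "k \<in> idx D" and ax: "\<tau> D i \<chi> (axis D j) = axis D k"
    using jk unfolding conj_pairs_iff_axis[OF D i \<chi>] by auto
  have a: "axis D j \<in> carrier (alg D)"
    using D e j by (auto simp: stable_unique_def intro: axis_closed)
  have "compose (carrier (alg D)) \<phi> (\<tau> D i \<chi>) = compose (carrier (alg D)) (\<tau> E (\<psi> i) \<chi>) \<phi>"
    using f i \<chi> stable_unique_dec[OF D] stable_unique_dec[OF E]
    by (intro miyamoto_map_natural) (auto simp: axdec_hom_def)
  from fun_cong[OF this, of "axis D j"] a have "\<phi> (\<tau> D i \<chi> (axis D j)) = \<tau> E (\<psi> i) \<chi> (\<phi> (axis D j))"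
    by (simp add: compose_eq)
  then have "\<tau> E (\<psi> i) \<chi> (axis E (\<psi> j)) = axis E (\<psi> k)"
    using ax f'(4) j k by simp
  then show ?thesis
    unfolding conj_pairs_iff_axis[OF E f'(5)[OF i] \<chi>] using f'(5) j k by blast
qed

section \<open>Functoriality of the universal Miyamoto group\<close>

abbreviation Y_copy :: "'i \<Rightarrow> ('g \<Rightarrow> 'r) monoid" where
  "Y_copy \<equiv> \<lambda>i. (character_group R \<Gamma>)\<lparr>carrier := Y\<rparr>"

lemma group_family_Y: "group_family I Y_copy"
  by (rule group_family.intro)
    (rule subgroup.subgroup_is_group[OF subgroup_Y group_character_group[OF cring_R group_\<Gamma>]])

lemma group_miy_free_product: "group (miy_free_product R \<Gamma> Y D)"
proof -
  interpret group_family "idx D" Y_copy by (rule group_family_Y)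
  show ?thesis unfolding miy_free_product_def by (rule free_product.is_group)
qed

lemma miy_letter_closed:
  assumes "i \<in> idx D" "\<chi> \<in> Y"
  shows "miy_letter R \<Gamma> Y D i \<chi> \<in> carrier (miy_free_product R \<Gamma> Y D)"
proof -
  interpret group_family "idx D" Y_copy by (rule group_family_Y)
  show ?thesis using assms by (simp add: miy_free_product_def miy_letter_def)
qed

lemma miy_letter_hom:
  assumes "i \<in> idx D"
  shows "miy_letter R \<Gamma> Y D i \<in> hom (Y_copy i) (miy_free_product R \<Gamma> Y D)"
proof -
  interpret group_family "idx D" Y_copy by (rule group_family_Y)
  show ?thesis
    using assms mult_class_letters[OF assms]
    by (intro homI) (auto simp: miy_letter_closed miy_letter_def miy_free_product_def)
qed

lemma miy_relations_closed:
  "miy_relations R \<Phi> \<Gamma> \<xi> Y D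
    \<subseteq> carrier (miy_free_product R \<Gamma> Y D) \<times> carrier (miy_free_product R \<Gamma> Y D)"
proof -
  interpret group "miy_free_product R \<Gamma> Y D" by (rule group_miy_free_product)
  show ?thesis by (auto simp: miy_relations_def conj_pairs_def Let_def miy_letter_closed)
qed

lemma normal_miy_kernel: "miy_kernel R \<Phi> \<Gamma> \<xi> Y D \<lhd> miy_free_product R \<Gamma> Y D"
  unfolding miy_kernel_def
  by (rule group.normal_relation_subgroup[OF group_miy_free_product miy_relations_closed])

lemma group_Miy_hat: "group (Miy_hat R \<Phi> \<Gamma> \<xi> Y D)"
  unfolding Miy_hat_def by (rule normal.factorgroup_is_group[OF normal_miy_kernel])

definition miy_proj where
  "miy_proj D P = miy_kernel R \<Phi> \<Gamma> \<xi> Y D #>\<^bsub>miy_free_product R \<Gamma> Y D\<^esub> P"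

lemma miy_proj_hom: "miy_proj D \<in> hom (miy_free_product R \<Gamma> Y D) (Miy_hat R \<Phi> \<Gamma> \<xi> Y D)"
  unfolding miy_proj_def[abs_def] Miy_hat_def by (rule normal.r_coset_hom_Mod[OF normal_miy_kernel])

lemma miy_proj_surj:
  "carrier (Miy_hat R \<Phi> \<Gamma> \<xi> Y D) = miy_proj D ` carrier (miy_free_product R \<Gamma> Y D)"
  by (auto simp: Miy_hat_def carrier_FactGroup miy_proj_def)

lemma miy_gen_eq: "miy_gen R \<Phi> \<Gamma> \<xi> Y D i \<chi> = miy_proj D (miy_letter R \<Gamma> Y D i \<chi>)"
  by (simp add: miy_gen_def miy_proj_def)

lemma miy_gen_closed:
  "i \<in> idx D \<Longrightarrow> \<chi> \<in> Y \<Longrightarrow> miy_gen R \<Phi> \<Gamma> \<xi> Y D i \<chi> \<in> carrier (Miy_hat R \<Phi> \<Gamma> \<xi> Y D)"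
  by (auto simp: miy_gen_eq miy_proj_surj miy_letter_closed)

lemma miy_proj_relation:
  "(u, v) \<in> miy_relations R \<Phi> \<Gamma> \<xi> Y D \<Longrightarrow> miy_proj D u = miy_proj D v"
  unfolding miy_proj_def miy_kernel_def
  by (rule group.relation_subgroup_rcos_eq[OF group_miy_free_product miy_relations_closed])

text \<open>
  The symbols generate the free product, hence also its quotient.
\<close>

lemma Miy_hat_hom_eqI:
  assumes H: "group H" and h: "h \<in> hom (Miy_hat R \<Phi> \<Gamma> \<xi> Y D) H" and k: "k \<in> hom (Miy_hat R \<Phi> \<Gamma> \<xi> Y D) H"
    and ext: "h \<in> extensional (carrier (Miy_hat R \<Phi> \<Gamma> \<xi> Y D))"
      "k \<in> extensional (carrier (Miy_hat R \<Phi> \<Gamma> \<xi> Y D))"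
    and gen: "\<And>i \<chi>. \<lbrakk>i \<in> idx D; \<chi> \<in> Y\<rbrakk> \<Longrightarrow>
      h (miy_gen R \<Phi> \<Gamma> \<xi> Y D i \<chi>) = k (miy_gen R \<Phi> \<Gamma> \<xi> Y D i \<chi>)"
  shows "h = k"
proof (rule extensionalityI[OF ext])
  interpret group_family "idx D" Y_copy by (rule group_family_Y)
  have proj: "miy_proj D \<in> hom (free_product (idx D) Y_copy) (Miy_hat R \<Phi> \<Gamma> \<xi> Y D)"
    using miy_proj_hom[of D] by (simp add: miy_free_product_def)
  fix p assume "p \<in> carrier (Miy_hat R \<Phi> \<Gamma> \<xi> Y D)"
  then obtain P where P: "P \<in> carrier (free_product (idx D) Y_copy)" "p = miy_proj D P"
    unfolding miy_proj_surj by (auto simp: miy_free_product_def)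
  have "(h \<circ> miy_proj D) P = (k \<circ> miy_proj D) P"
  proof (rule hom_eqI[OF H _ _ _ P(1)])
    show "h \<circ> miy_proj D \<in> hom (free_product (idx D) Y_copy) H"
      "k \<circ> miy_proj D \<in> hom (free_product (idx D) Y_copy) H"
      using proj h k by (auto intro: Group.hom_compose)
  qed (use gen in \<open>auto simp: miy_gen_eq miy_letter_def\<close>)
  with P(2) show "h p = k p" by simp
qed

text \<open>
  The universal property of the presentation: a homomorphism from the free product that equalizes
  the two sides of every relation has the normal closure of the relators in its kernel.
\<close>

lemma Miy_hat_hom_exists:
  assumes H: "group H" and f: "\<And>i. i \<in> idx D \<Longrightarrow> f i \<in> hom (Y_copy i) H"
    and rel: "\<And>i \<chi> j k \<chi>'. \<lbrakk>i \<in> idx D; \<chi> \<in> Y; \<chi>' \<in> Y;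
        (j, k) \<in> conj_pairs R \<Phi> \<Gamma> \<xi> Y D (\<tau> D i \<chi>)\<rbrakk> \<Longrightarrow>
      f i \<chi> \<otimes>\<^bsub>H\<^esub> f j \<chi>' \<otimes>\<^bsub>H\<^esub> inv\<^bsub>H\<^esub> f i \<chi> = f k \<chi>'"
  obtains h where "h \<in> hom (Miy_hat R \<Phi> \<Gamma> \<xi> Y D) H"
    and "\<And>i \<chi>. \<lbrakk>i \<in> idx D; \<chi> \<in> Y\<rbrakk> \<Longrightarrow> h (miy_gen R \<Phi> \<Gamma> \<xi> Y D i \<chi>) = f i \<chi>"
proof -
  let ?P = "miy_free_product R \<Gamma> Y D" and ?t = "miy_letter R \<Gamma> Y D"
  interpret group_family "idx D" Y_copy by (rule group_family_Y)
  obtain h0 where "h0 \<in> hom (free_product (idx D) Y_copy) H"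
    "\<And>i \<chi>. \<lbrakk>i \<in> idx D; \<chi> \<in> carrier (Y_copy i)\<rbrakk> \<Longrightarrow>
      h0 (free_product_class (idx D) Y_copy [(i, \<chi>)]) = f i \<chi>"
    using hom_exists[where f = f, OF H f] by blast
  then have h0: "h0 \<in> hom ?P H" "\<And>i \<chi>. \<lbrakk>i \<in> idx D; \<chi> \<in> Y\<rbrakk> \<Longrightarrow> h0 (?t i \<chi>) = f i \<chi>"
    by (simp_all add: miy_free_product_def miy_letter_def)
  interpret h0: group_hom ?P H h0
    by (intro group_hom.intro group_hom_axioms.intro group_miy_free_product H h0(1))
  have "miy_kernel R \<Phi> \<Gamma> \<xi> Y D \<subseteq> kernel ?P H h0"
    unfolding miy_kernel_def
  proof (rule h0.relation_subgroup_le_kernel)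
    fix u v assume uv: "(u, v) \<in> miy_relations R \<Phi> \<Gamma> \<xi> Y D"
    then obtain i \<chi> j k \<chi>' where i: "i \<in> idx D" and \<chi>: "\<chi> \<in> Y" and \<chi>': "\<chi>' \<in> Y"
      and jk: "(j, k) \<in> conj_pairs R \<Phi> \<Gamma> \<xi> Y D (\<tau> D i \<chi>)"
      and u: "u = ?t i \<chi> \<otimes>\<^bsub>?P\<^esub> ?t j \<chi>' \<otimes>\<^bsub>?P\<^esub> inv\<^bsub>?P\<^esub> (?t i \<chi>)" and v: "v = ?t k \<chi>'"
      by (auto simp: miy_relations_def Let_def)
    have "j \<in> idx D" "k \<in> idx D" using jk by (auto simp: conj_pairs_def)
    then have "h0 u = h0 v"
      unfolding u v using i \<chi> \<chi>' rel[OF i \<chi> \<chi>' jk] by (simp add: miy_letter_closed h0(2))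
    then show "u \<in> carrier ?P \<and> v \<in> carrier ?P \<and> h0 u = h0 v"
      using uv miy_relations_closed by blast
  qed
  then obtain h where h: "h \<in> hom (Miy_hat R \<Phi> \<Gamma> \<xi> Y D) H"
    "\<And>P. P \<in> carrier ?P \<Longrightarrow> h (miy_proj D P) = h0 P"
    using h0.FactGroup_universal_kernel[OF normal_miy_kernel] by (auto simp: Miy_hat_def miy_proj_def)
  show thesis
    by (rule that[OF h(1)]) (simp add: miy_gen_eq h(2) miy_letter_closed h0(2))
qed

text \<open>
  The symbols \<open>t\<^sub>\<psi>\<^sub>i\<^sub>,\<^sub>\<chi>\<close> satisfy in the second group the relations that define the first one,
  because \<open>\<psi>\<close> preserves conjugation pairs.
\<close>

lemma ex1_Miy_hat_map:
  assumes e: "e \<in> labels \<Phi>" and D: "stable_unique e lam D" and E: "stable_unique e lam E"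
    and f: "f \<in> axdec_hom R \<Phi> D E"
  shows "\<exists>!h. is_Miy_hat_map R \<Phi> \<Gamma> \<xi> Y D E f h"
proof -
  let ?H = "Miy_hat R \<Phi> \<Gamma> \<xi> Y E" and ?P = "miy_free_product R \<Gamma> Y E"
  obtain \<phi> \<psi> where f_eq: "f = (\<phi>, \<psi>)" by fastforce
  note f' = axdec_homD(5)[OF f[unfolded f_eq]]
  interpret proj: group_hom ?P ?H "miy_proj E"
    by (intro group_hom.intro group_hom_axioms.intro group_miy_free_product group_Miy_hat miy_proj_hom)
  let ?f = "\<lambda>i \<chi>. miy_gen R \<Phi> \<Gamma> \<xi> Y E (\<psi> i) \<chi>"
  obtain h where h: "h \<in> hom (Miy_hat R \<Phi> \<Gamma> \<xi> Y D) ?H"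
    "\<And>i \<chi>. \<lbrakk>i \<in> idx D; \<chi> \<in> Y\<rbrakk> \<Longrightarrow> h (miy_gen R \<Phi> \<Gamma> \<xi> Y D i \<chi>) = ?f i \<chi>"
  proof (rule Miy_hat_hom_exists[where f = ?f])
    show "group ?H" by (rule group_Miy_hat)
    show "?f i \<in> hom (Y_copy i) ?H" if "i \<in> idx D" for i
      using Group.hom_compose[OF miy_letter_hom[OF f'[OF that]] miy_proj_hom]
      by (simp add: miy_gen_eq o_def)
    fix i \<chi> j k \<chi>' assume i: "i \<in> idx D" and \<chi>: "\<chi> \<in> Y" "\<chi>' \<in> Y"
      and jk: "(j, k) \<in> conj_pairs R \<Phi> \<Gamma> \<xi> Y D (\<tau> D i \<chi>)"
    have j: "j \<in> idx D" using jk by (auto simp: conj_pairs_def)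
    let ?t = "miy_letter R \<Gamma> Y E"
    have "(?t (\<psi> i) \<chi> \<otimes>\<^bsub>?P\<^esub> ?t (\<psi> j) \<chi>' \<otimes>\<^bsub>?P\<^esub> inv\<^bsub>?P\<^esub> (?t (\<psi> i) \<chi>), ?t (\<psi> k) \<chi>')
        \<in> miy_relations R \<Phi> \<Gamma> \<xi> Y E"
      using conj_pairs_mono[OF e D E f[unfolded f_eq] i \<chi>(1) jk] f'[OF i] \<chi>
      unfolding miy_relations_def Let_def by blast
    from miy_proj_relation[OF this]
    show "?f i \<chi> \<otimes>\<^bsub>?H\<^esub> ?f j \<chi>' \<otimes>\<^bsub>?H\<^esub> inv\<^bsub>?H\<^esub> ?f i \<chi> = ?f k \<chi>'"
      using i j \<chi> f' by (simp add: miy_letter_closed miy_gen_eq)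
  qed blast
  \<comment> \<open>Morphisms of groups are extensional, which the universal property does not guarantee.\<close>
  let ?h = "restrict h (carrier (Miy_hat R \<Phi> \<Gamma> \<xi> Y D))"
  have "?h \<in> hom (Miy_hat R \<Phi> \<Gamma> \<xi> Y D) ?H"
    using h(1) group.is_monoid[OF group_Miy_hat[of D]]
    by (auto simp: hom_def monoid.m_closed)
  then have "is_Miy_hat_map R \<Phi> \<Gamma> \<xi> Y D E f ?h"
    using h(2) by (auto simp: is_Miy_hat_map_def Grp_def f_eq miy_gen_closed)
  moreover have "k = k'" if "is_Miy_hat_map R \<Phi> \<Gamma> \<xi> Y D E f k" "is_Miy_hat_map R \<Phi> \<Gamma> \<xi> Y D E f k'" for k k'
    using that by (intro Miy_hat_hom_eqI[OF group_Miy_hat]) (auto simp: is_Miy_hat_map_def Grp_def)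
  ultimately show ?thesis by blast
qed

lemma is_Miy_hat_map_Id:
  "is_Miy_hat_map R \<Phi> \<Gamma> \<xi> Y D D (\<theta>, \<lambda>i\<in>idx D. i) (\<lambda>p\<in>carrier (Miy_hat R \<Phi> \<Gamma> \<xi> Y D). p)"
proof -
  interpret group "Miy_hat R \<Phi> \<Gamma> \<xi> Y D" by (rule group_Miy_hat)
  have "(\<lambda>p\<in>carrier (Miy_hat R \<Phi> \<Gamma> \<xi> Y D). p) \<in> hom (Miy_hat R \<Phi> \<Gamma> \<xi> Y D) (Miy_hat R \<Phi> \<Gamma> \<xi> Y D)"
    by (intro homI) auto
  then show ?thesis
    by (simp add: is_Miy_hat_map_def Grp_def miy_gen_closed)
qed

lemma is_Miy_hat_map_compose:
  assumes \<psi>: "snd f \<in> idx D \<rightarrow> idx E"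
    and h: "is_Miy_hat_map R \<Phi> \<Gamma> \<xi> Y D E f h" and k: "is_Miy_hat_map R \<Phi> \<Gamma> \<xi> Y E F g k"
  shows "is_Miy_hat_map R \<Phi> \<Gamma> \<xi> Y D F (\<theta>, compose (idx D) (snd g) (snd f))
    (compose (carrier (Miy_hat R \<Phi> \<Gamma> \<xi> Y D)) k h)"
proof -
  interpret group "Miy_hat R \<Phi> \<Gamma> \<xi> Y D" by (rule group_Miy_hat)
  have "compose (carrier (Miy_hat R \<Phi> \<Gamma> \<xi> Y D)) k h
      \<in> hom (Miy_hat R \<Phi> \<Gamma> \<xi> Y D) (Miy_hat R \<Phi> \<Gamma> \<xi> Y F)"
    using h k by (auto simp: is_Miy_hat_map_def Grp_def hom_compose)
  then show ?thesis
    using h k \<psi> by (auto simp: is_Miy_hat_map_def Grp_def compose_eq Pi_iff miy_gen_closed)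
qed

end

theorem theorem6p12:
  fixes R :: "'r ring" and \<Gamma> :: "'g monoid" and Y :: "('g \<Rightarrow> 'r) set"
    and \<Phi> :: "'x fusion" and e :: 'x and \<xi> :: "'x \<Rightarrow> 'g" and lam :: "'x \<Rightarrow> 'r"
  assumes "cring R"
    and "group \<Gamma>" and "finite (carrier \<Gamma>)"
    and "subgroup Y (character_group R \<Gamma>)"
    and "is_fusion_law \<Phi>" and "is_fusion_unit \<Phi> e" and "is_grading \<Phi> \<Gamma> \<xi>"
    and "lam \<in> labels \<Phi> \<rightarrow> carrier R"
  defines "C \<equiv> (stable_unique_AxDec R \<Phi> e lam \<Gamma> \<xi> Y
      :: (('r, 'a, 'i, 'x) axdec_algebra, ('a \<Rightarrow> 'a) \<times> ('i \<Rightarrow> 'i)) cat)"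
  shows "(\<forall>D\<in>Ob C. \<forall>E\<in>Ob C. \<forall>f\<in>Hom C D E. \<exists>!h. is_Miy_hat_map R \<Phi> \<Gamma> \<xi> Y D E f h) \<and>
    is_functor C Grp (Miy_hat R \<Phi> \<Gamma> \<xi> Y) (Miy_hat_map R \<Phi> \<Gamma> \<xi> Y)"
proof -
  interpret graded_characters R \<Gamma> Y \<Phi> \<xi>
    by (intro graded_characters.intro assms(1,2,4,7))
  let ?M = "Miy_hat R \<Phi> \<Gamma> \<xi> Y" and ?m = "Miy_hat_map R \<Phi> \<Gamma> \<xi> Y"
  have e: "e \<in> labels \<Phi>" using assms(6) by (simp add: is_fusion_unit_def)
  have C: "is_category C"
    unfolding C_def stable_unique_AxDec_def
    by (rule is_category_full_subcategory[OF is_category_AxDec[OF e]])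
  have C_simps: "Ob C = {D. stable_unique e lam D}" "Hom C = axdec_hom R \<Phi>"
    "Id C D = (\<lambda>a\<in>carrier (alg D). a, \<lambda>i\<in>idx D. i)"
    "Comp C D E F g f = (compose (carrier (alg D)) (fst g) (fst f), compose (idx D) (snd g) (snd f))"
    for D E F f g
    by (auto simp: C_def stable_unique_AxDec_def AxDec_def stable_unique_def)
  have ex1: "\<exists>!h. is_Miy_hat_map R \<Phi> \<Gamma> \<xi> Y D E f h"
    if "D \<in> Ob C" "E \<in> Ob C" "f \<in> Hom C D E" for D E f
    using that ex1_Miy_hat_map[OF e, of lam D E f] by (simp add: C_simps)
  have map: "is_Miy_hat_map R \<Phi> \<Gamma> \<xi> Y D E f (?m D E f)"
    if "D \<in> Ob C" "E \<in> Ob C" "f \<in> Hom C D E" for D E f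
    unfolding Miy_hat_map_def using ex1[OF that] by (rule theI')
  have "is_functor C Grp ?M ?m"
    unfolding is_functor_def
  proof (intro conjI ballI)
    fix D assume D: "D \<in> Ob C"
    then show "?M D \<in> Ob Grp" by (simp add: Grp_def group_Miy_hat)
    have "Id C D \<in> Hom C D D" using C D by (auto simp: is_category_def)
    \<comment> \<open>The identity sends each symbol to itself, so it is the map that \<open>Miy_hat_map\<close> selects.
         The composite of two induced maps is recognized in the same way below.\<close>
    from ex1[OF D D this] map[OF D D this] show "?m D D (Id C D) = Id Grp (?M D)"
      using is_Miy_hat_map_Id by (auto simp: C_simps Grp_def)
  next
    fix D E f assume "D \<in> Ob C" "E \<in> Ob C" "f \<in> Hom C D E"
    then show "?m D E f \<in> Hom Grp (?M D) (?M E)"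
      using map by (simp add: is_Miy_hat_map_def)
  next
    fix D E F f g assume D: "D \<in> Ob C" and E: "E \<in> Ob C" and F: "F \<in> Ob C"
      and f: "f \<in> Hom C D E" and g: "g \<in> Hom C E F"
    have gf: "Comp C D E F g f \<in> Hom C D F"
      using C D E F f g by (simp add: is_category_def)
    have "snd f \<in> idx D \<rightarrow> idx E"
      using f axdec_homD(5)[of "fst f" "snd f"] by (auto simp: C_simps)
    from is_Miy_hat_map_compose[OF this map[OF D E f] map[OF E F g]]
    have "is_Miy_hat_map R \<Phi> \<Gamma> \<xi> Y D F (Comp C D E F g f)
        (compose (carrier (?M D)) (?m E F g) (?m D E f))"
      by (simp add: C_simps)
    with ex1[OF D F gf] map[OF D F gf]
    show "?m D F (Comp C D E F g f) = Comp Grp (?M D) (?M E) (?M F) (?m E F g) (?m D E f)"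
      by (auto simp: Grp_def)
  qed (rule C is_category_Grp)+
  with ex1 show ?thesis by blast
qed

end
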